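(* Let $n$ be a positive integer with $n\equiv 1\pmod 4$, let $a,b$ be indeterminates, and let $M=(n-1)/2$ or $M=n-1$. Then, modulo $[n](1-aq^n)(a-q^n)(b-q^n)$, \[ \sum_{k=0}^{M}[6k+1]\frac{(q,aq,q/a;q^2)_k(q/b;q^4)_k}{(q^4,q^4/a,aq^4;q^4)_k(bq^2;q^2)_k}q^{k^2+k}b^{k} \equiv\frac{(b-q^n)(ab-1-a^2+aq^n)}{(a-b)(1-ab)}\frac{(q^5,q^2/b;q^4)_{(n-1)/4}}{(q,bq^4;q^4)_{(n-1)/4}}\bigg(\frac{b}{q}\bigg)^{\frac{n-1}{4}} +\frac{(1-aq^n)(a-q^n)}{(a-b)(1-ab)}\frac{(q^3,q^5;q^4)_{(n-1)/4}}{(aq^4,q^4/a;q^4)_{(n-1)/4}}. \]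
   Context: For $x$ and integer $n\ge 0$, $(x;q)_n=\prod_{j=0}^{n-1}(1-xq^j)$, and $(x_1,\dots,x_m;q)_n=(x_1;q)_n\cdots(x_m;q)_n$. $[r]=(1-q^r)/(1-q)$ is the $q$-integer. A congruence modulo a polynomial $P$ in $q,a,b$ between rational functions whose denominators are coprime to $P$ means that the difference is a rational function whose numerator is divisible by $P$ and whose denominator is coprime to $P$. *)

theory Defs
  imports "HOL-Computational_Algebra.Computational_Algebra"
begin

(* The constant "divide" is written "div" here so that one definition covers both fields and
   polynomial rings; in the latter the division is exact, see q_int_mult below. *)
definition q_int :: "'a::idom_divide \<Rightarrow> nat \<Rightarrow> 'a" where
  "q_int q r = (1 - q ^ r) div (1 - q)"

lemma q_int_eq_sum:
  assumes "q \<noteq> (1 :: 'a::idom_divide)"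
  shows "q_int q r = (\<Sum>i<r. q ^ i)"
  using assms by (simp add: q_int_def one_diff_power_eq)

lemma q_int_mult:
  assumes "q \<noteq> (1 :: 'a::idom_divide)"
  shows "(1 - q) * q_int q r = 1 - q ^ r"
  using q_int_eq_sum[OF assms, of r] by (simp add: one_diff_power_eq)

definition q_poch :: "'a::comm_ring_1 \<Rightarrow> 'a \<Rightarrow> nat \<Rightarrow> 'a" where
  "q_poch x q n = (\<Prod>j<n. 1 - x * q ^ j)"

(* q_pochs [x1, ..., xm] q n stands for (x1, ..., xm; q)_n *)
definition q_pochs :: "'a::comm_ring_1 list \<Rightarrow> 'a \<Rightarrow> nat \<Rightarrow> 'a" where
  "q_pochs xs q n = (\<Prod>x\<leftarrow>xs. q_poch x q n)"

definition denom_coprime :: "'a::{idom, algebraic_semidom} \<Rightarrow> 'a fract \<Rightarrow> bool" where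
  "denom_coprime P x \<longleftrightarrow>
     (\<exists>N D. D \<noteq> 0 \<and> coprime D P \<and> x = Fraction_Field.Fract N D)"

(* Congruence modulo P is a relation between fractions whose denominators are coprime to P.
   A fraction has a representation with denominator coprime to P iff its reduced form does,
   so common factors of numerator and denominator play no role. *)
definition fract_cong ::
    "'a::{idom, algebraic_semidom} fract \<Rightarrow> 'a fract \<Rightarrow> 'a \<Rightarrow> bool" where
  "fract_cong x y P \<longleftrightarrow>
     denom_coprime P x \<and> denom_coprime P y \<and>
     (\<exists>N D. D \<noteq> 0 \<and> coprime D P \<and> P dvd N \<and> x - y = Fraction_Field.Fract N D)"

(* Q[q, a, b], realised as Q[q][a][b] *)
type_synonym pol = "rat poly poly poly"

definition q_pol :: pol where "q_pol = [:[:[:0, 1:]:]:]"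
definition a_pol :: pol where "a_pol = [:[:0, 1:]:]"
definition b_pol :: pol where "b_pol = [:0, 1:]"

definition to_fr :: "'a::idom \<Rightarrow> 'a fract" where
  "to_fr p = Fraction_Field.Fract p 1"

end

theory Submission
  imports Defs "HOL-Computational_Algebra.Field_as_Ring"
begin

text \<open>Let \<open>S b\<close> be the left-hand sum. Since \<open>S b\<close> satisfies a first-order recurrence relating \<open>S (b q\<^sup>4)\<close>
  to \<open>S b\<close>, with an inhomogeneous term that comes from the upper summation bound, and since \<open>S q = 1\<close>,
  all its values at \<open>b = q ^ (4 N + 1)\<close> are known as long as that term vanishes. This gives the
  congruence modulo \<open>b - q ^ n\<close>. For \<open>a = q ^ n\<close> or \<open>a = q ^ (- n)\<close> the inhomogeneous term is always \<open>0\<close>, so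
  \<open>S b\<close> is known at infinitely many points, and hence everywhere, being rational in \<open>b\<close>.
  Finally, modulo \<open>[n]\<close> the inhomogeneous term vanishes as well. As \<open>q ^ n = 1\<close> there, \<open>n\<close> steps of the
  recurrence lead from \<open>b\<close> back to \<open>b\<close>; the accumulated factors on the two sides differ by a unit,
  which forces \<open>S b = 0\<close>.\<close>

subsection \<open>Congruences of fractions\<close>

text \<open>The right-hand side is a Chinese remainder interpolation: its two coefficients are 1 and
  0 if \<open>a = q ^ n\<close> or \<open>a = 1 / q ^ n\<close>, and 0 and 1 if
  \<open>b = q ^ n\<close>, while modulo \<open>[n]\<close> both closed forms vanish. So four
  pairwise coprime moduli can be treated separately. Evaluation means replacing \<open>a\<close> or
  \<open>b\<close> by a congruent element of the same fraction field, which is legitimate as long as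
  the denominators involved are coprime to the modulus. Securing this is the main obstacle. For
  composite \<open>n\<close> the denominators \<open>1 - q ^ (4 * j + 4)\<close> can share
  cyclotomic factors with \<open>[n]\<close>, which have to be cancelled against
  \<open>(q; q ^ 2)_k\<close>. Moreover \<open>[n]\<close> is then reducible, so a factor that is
  merely nonzero modulo \<open>[n]\<close> may not be cancelled; coprimality is obtained by
  specialising \<open>a\<close> and \<open>b\<close> to suitable polynomials in \<open>q\<close>.
  The step from \<open>b\<close> to \<open>b q ^ 4\<close> comes from the base of
  \<open>(q / b; q ^ 4)_k\<close>: it moves this numerator by one factor and the denominator
  \<open>(b q ^ 2; q ^ 2)_k\<close> by two.\<close>

lemma to_fr_0: "to_fr 0 = 0"
  and to_fr_1: "to_fr 1 = 1"
  and to_fr_add: "to_fr (x + y) = to_fr x + to_fr y"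
  and to_fr_diff: "to_fr (x - y) = to_fr x - to_fr y"
  and to_fr_uminus: "to_fr (- x) = - to_fr x"
  and to_fr_mult: "to_fr (x * y) = to_fr x * to_fr y"
  by (simp_all add: to_fr_def Zero_fract_def One_fract_def)

lemma to_fr_power: "to_fr (x ^ n) = to_fr x ^ n"
  by (induction n) (simp_all add: to_fr_1 to_fr_mult)

lemmas to_fr_simps = to_fr_0 to_fr_1 to_fr_add to_fr_diff to_fr_uminus to_fr_mult to_fr_power

lemma to_fr_prod: "to_fr (prod f A) = (\<Prod>x\<in>A. to_fr (f x))"
  by (induction A rule: infinite_finite_induct) (simp_all add: to_fr_simps)

lemma to_fr_eq_iff [simp]: "to_fr x = to_fr y \<longleftrightarrow> x = y"
  by (simp add: to_fr_def eq_fract)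

lemma to_fr_eq_0_iff [simp]: "to_fr x = 0 \<longleftrightarrow> x = 0"
  by (metis to_fr_eq_iff to_fr_simps(1))

lemma Fract_eq_to_fr: "Fraction_Field.Fract x y = to_fr x / to_fr y"
  by (simp add: to_fr_def)

lemma denom_coprime_iff:
  "denom_coprime p x \<longleftrightarrow> (\<exists>N D. D \<noteq> 0 \<and> coprime D p \<and> x = to_fr N / to_fr D)"
  by (simp add: denom_coprime_def Fract_eq_to_fr)

text \<open>These are the admissible denominators. The condition \<open>d \<noteq> 0\<close> matters
  if \<open>p\<close> is a unit, as \<open>[n]\<close> is for \<open>n = 1\<close>: then 0 is
  coprime to \<open>p\<close> as well.\<close>

definition coprime_fr :: "'a::{idom, algebraic_semidom} \<Rightarrow> 'a fract \<Rightarrow> bool" where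
  "coprime_fr p x \<longleftrightarrow> (\<exists>d. d \<noteq> 0 \<and> coprime d p \<and> x = to_fr d)"

context
  fixes p :: "'a::{idom, semiring_gcd}"
begin

lemma denom_coprime_to_fr [simp, intro]: "denom_coprime p (to_fr x)"
  unfolding denom_coprime_iff by (rule exI[of _ x], rule exI[of _ 1]) (simp add: to_fr_simps)

lemma denom_coprime_0 [simp, intro]: "denom_coprime p 0"
  and denom_coprime_1 [simp, intro]: "denom_coprime p 1"
  using denom_coprime_to_fr[of 0] denom_coprime_to_fr[of 1] by (simp_all only: to_fr_simps)

lemma denom_coprime_add [intro]:
  assumes "denom_coprime p x" "denom_coprime p y"
  shows "denom_coprime p (x + y)"
proof -
  from assms obtain N D N' D' where "D \<noteq> 0" "coprime D p" "x = to_fr N / to_fr D"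
    "D' \<noteq> 0" "coprime D' p" "y = to_fr N' / to_fr D'"
    unfolding denom_coprime_iff by blast
  then show ?thesis
    unfolding denom_coprime_iff
    by (intro exI[of _ "N * D' + N' * D"] exI[of _ "D * D'"]) (simp add: to_fr_simps field_simps)
qed

lemma denom_coprime_mult [intro]:
  assumes "denom_coprime p x" "denom_coprime p y"
  shows "denom_coprime p (x * y)"
proof -
  from assms obtain N D N' D' where "D \<noteq> 0" "coprime D p" "x = to_fr N / to_fr D"
    "D' \<noteq> 0" "coprime D' p" "y = to_fr N' / to_fr D'"
    unfolding denom_coprime_iff by blast
  then show ?thesis
    unfolding denom_coprime_iff
    by (intro exI[of _ "N * N'"] exI[of _ "D * D'"]) (simp add: to_fr_simps)
qed

lemma denom_coprime_uminus [intro]: "denom_coprime p x \<Longrightarrow> denom_coprime p (- x)"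
  using denom_coprime_mult[OF denom_coprime_to_fr[of "-1"], of x] by (simp add: to_fr_simps)

lemma denom_coprime_diff [intro]:
  "denom_coprime p x \<Longrightarrow> denom_coprime p y \<Longrightarrow> denom_coprime p (x - y)"
  using denom_coprime_add[OF _ denom_coprime_uminus, of x y] by simp

lemma denom_coprime_power [intro]: "denom_coprime p x \<Longrightarrow> denom_coprime p (x ^ n)"
  by (induction n) auto

lemma denom_coprime_sum [intro]:
  "(\<And>i. i \<in> A \<Longrightarrow> denom_coprime p (f i)) \<Longrightarrow> denom_coprime p (sum f A)"
  by (induction A rule: infinite_finite_induct) auto

lemma denom_coprime_prod [intro]:
  "(\<And>i. i \<in> A \<Longrightarrow> denom_coprime p (f i)) \<Longrightarrow> denom_coprime p (prod f A)"
  by (induction A rule: infinite_finite_induct) auto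

lemma coprime_fr_imp_nonzero: "coprime_fr p x \<Longrightarrow> x \<noteq> 0"
  by (auto simp: coprime_fr_def)

lemma coprime_fr_mult [intro]: "coprime_fr p x \<Longrightarrow> coprime_fr p y \<Longrightarrow> coprime_fr p (x * y)"
  unfolding coprime_fr_def by (metis coprime_mult_left_iff mult_eq_0_iff to_fr_mult)

lemma coprime_fr_prod [intro]:
  "(\<And>i. i \<in> A \<Longrightarrow> coprime_fr p (f i)) \<Longrightarrow> coprime_fr p (prod f A)"
proof (induction A rule: infinite_finite_induct)
  have "coprime_fr p 1"
    unfolding coprime_fr_def by (rule exI[of _ 1]) (simp add: to_fr_simps)
  then show "coprime_fr p (prod f {})" "infinite A \<Longrightarrow> coprime_fr p (prod f A)" for A
    by simp_all
qed auto

lemma coprime_fr_power [intro]: "coprime_fr p x \<Longrightarrow> coprime_fr p (x ^ n)"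
  using coprime_fr_prod[of "{..<n}" "\<lambda>_. x"] by simp

lemma denom_coprime_divide [intro]:
  assumes "denom_coprime p x" "coprime_fr p y"
  shows "denom_coprime p (x / y)"
proof -
  from assms(2) obtain d where "d \<noteq> 0" "coprime d p" "y = to_fr d"
    by (auto simp: coprime_fr_def)
  then have "denom_coprime p (1 / y)"
    unfolding denom_coprime_iff by (intro exI[of _ 1] exI[of _ d]) (simp add: to_fr_simps)
  with assms(1) have "denom_coprime p (x * (1 / y))"
    by blast
  then show ?thesis by simp
qed

lemma fract_cong_iff:
  "fract_cong x y p \<longleftrightarrow>
     denom_coprime p x \<and> denom_coprime p y \<and> (\<exists>z. denom_coprime p z \<and> x - y = to_fr p * z)"
proof -
  have "(\<exists>N D. D \<noteq> 0 \<and> coprime D p \<and> p dvd N \<and> x - y = Fraction_Field.Fract N D) \<longleftrightarrow>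
        (\<exists>z. denom_coprime p z \<and> x - y = to_fr p * z)"
    (is "?L \<longleftrightarrow> ?R")
  proof
    assume ?L
    then obtain N D where "D \<noteq> 0" "coprime D p" "p dvd N" "x - y = to_fr N / to_fr D"
      by (auto simp: Fract_eq_to_fr)
    moreover from \<open>p dvd N\<close> obtain M where "N = p * M" ..
    ultimately have "x - y = to_fr p * (to_fr M / to_fr D)"
      by (simp add: to_fr_simps)
    with \<open>coprime D p\<close> \<open>D \<noteq> 0\<close> show ?R
      unfolding denom_coprime_iff by blast
  next
    assume ?R
    then obtain N D where "D \<noteq> 0" "coprime D p" "x - y = to_fr p * (to_fr N / to_fr D)"
      unfolding denom_coprime_iff by blast
    then show ?L
      by (intro exI[of _ "p * N"] exI[of _ D]) (simp add: Fract_eq_to_fr to_fr_simps)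
  qed
  then show ?thesis
    by (simp only: fract_cong_def)
qed

lemma fract_congI:
  "denom_coprime p x \<Longrightarrow> denom_coprime p y \<Longrightarrow> denom_coprime p z \<Longrightarrow> x - y = to_fr p * z
    \<Longrightarrow> fract_cong x y p"
  unfolding fract_cong_iff by blast

lemma fract_cong_imp_denom_coprime:
  assumes "fract_cong x y p"
  shows "denom_coprime p x" "denom_coprime p y"
  using assms by (simp_all add: fract_cong_iff)

lemma fract_cong_refl [intro]: "denom_coprime p x \<Longrightarrow> fract_cong x x p"
  by (rule fract_congI[of _ _ 0]) auto

lemma fract_cong_sym:
  assumes "fract_cong x y p"
  shows "fract_cong y x p"
proof -
  from assms obtain z where "denom_coprime p z" "x - y = to_fr p * z"
    "denom_coprime p x" "denom_coprime p y"
    unfolding fract_cong_iff by blast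
  then show ?thesis
    by (intro fract_congI[of _ _ "- z"]) (auto simp: algebra_simps)
qed

lemma fract_cong_add [intro]:
  assumes "fract_cong x y p" "fract_cong u v p"
  shows "fract_cong (x + u) (y + v) p"
proof -
  from assms obtain z w where *: "denom_coprime p z" "x - y = to_fr p * z"
      "denom_coprime p w" "u - v = to_fr p * w"
      "denom_coprime p x" "denom_coprime p y" "denom_coprime p u" "denom_coprime p v"
    unfolding fract_cong_iff by blast
  have "(x + u) - (y + v) = (x - y) + (u - v)"
    by simp
  also have "\<dots> = to_fr p * (z + w)"
    unfolding * by (simp add: algebra_simps)
  finally show ?thesis
    using * by (intro fract_congI[of _ _ "z + w"]) auto
qed

lemma fract_cong_mult [intro]:
  assumes "fract_cong x y p" "fract_cong u v p"
  shows "fract_cong (x * u) (y * v) p"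
proof -
  from assms obtain z w where *: "denom_coprime p z" "x - y = to_fr p * z"
      "denom_coprime p w" "u - v = to_fr p * w"
      "denom_coprime p x" "denom_coprime p y" "denom_coprime p u" "denom_coprime p v"
    unfolding fract_cong_iff by blast
  have "x * u - y * v = (x - y) * u + y * (u - v)"
    by (simp add: algebra_simps)
  also have "\<dots> = to_fr p * (z * u + y * w)"
    unfolding * by (simp add: algebra_simps)
  finally show ?thesis
    using * by (intro fract_congI[of _ _ "z * u + y * w"]) auto
qed

lemma fract_cong_diff [intro]:
  assumes "fract_cong x y p" "fract_cong u v p"
  shows "fract_cong (x - u) (y - v) p"
proof -
  have "fract_cong (x + to_fr (- 1) * u) (y + to_fr (- 1) * v) p"
    using assms by blast
  then show ?thesis by (simp add: to_fr_simps)
qed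

lemma fract_cong_trans:
  assumes "fract_cong x y p" "fract_cong y z p"
  shows "fract_cong x z p"
proof -
  have "fract_cong (x + y - y) (y + z - y) p"
    using assms by (blast dest: fract_cong_imp_denom_coprime)
  then show ?thesis by simp
qed

lemma fract_cong_power [intro]: "fract_cong x y p \<Longrightarrow> fract_cong (x ^ n) (y ^ n) p"
  by (induction n) auto

lemma fract_cong_sum [intro]:
  "(\<And>i. i \<in> A \<Longrightarrow> fract_cong (f i) (g i) p) \<Longrightarrow> fract_cong (sum f A) (sum g A) p"
  by (induction A rule: infinite_finite_induct) auto

lemma fract_cong_prod [intro]:
  "(\<And>i. i \<in> A \<Longrightarrow> fract_cong (f i) (g i) p) \<Longrightarrow> fract_cong (prod f A) (prod g A) p"
  by (induction A rule: infinite_finite_induct) auto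

text \<open>\<open>v\<close> is typically a value at \<open>1 / q ^ n\<close> and not a polynomial,
  so only nonvanishing is required of it. Coprimality passes over from \<open>u = d\<close>: with
  \<open>z = M / E\<close> one gets \<open>v = (d E - p M) / E\<close>, and a common divisor of
  \<open>d E - p M\<close> and \<open>p\<close> divides \<open>d E\<close>, which is coprime to
  \<open>p\<close>.\<close>

lemma fract_cong_divide [intro]:
  assumes xy: "fract_cong x y p" and uv: "fract_cong u v p"
    and u: "coprime_fr p u" and "v \<noteq> 0"
  shows "fract_cong (x / u) (y / v) p"
proof -
  from u obtain d where d: "d \<noteq> 0" "coprime d p" "u = to_fr d"
    by (auto simp: coprime_fr_def)
  from uv obtain z where z: "denom_coprime p z" "to_fr d - v = to_fr p * z"
    unfolding fract_cong_iff d by blast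
  then obtain M E where ME: "E \<noteq> 0" "coprime E p" "z = to_fr M / to_fr E"
    by (auto simp: denom_coprime_iff)
  have v: "v = to_fr (d * E - p * M) / to_fr E"
    using z(2) ME by (simp add: to_fr_simps field_simps)
  with \<open>v \<noteq> 0\<close> have nz: "d * E - p * M \<noteq> 0"
    by (metis div_0 to_fr_0)
  have "coprime (d * E - p * M) p"
  proof (rule coprimeI)
    fix c assume c: "c dvd d * E - p * M" "c dvd p"
    then have "c dvd (d * E - p * M) + p * M"
      by (blast intro: dvd_add dvd_mult2)
    with c(2) show "c dvd 1"
      using d ME coprime_common_divisor[of "d * E" p c] by simp
  qed
  with nz have cop: "coprime_fr p (to_fr (d * E - p * M))"
    by (auto simp: coprime_fr_def)
  have iv: "y / v = y * to_fr E / to_fr (d * E - p * M)"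
    unfolding v by simp
  have dc: "denom_coprime p (y / v)"
    unfolding iv using xy cop by (blast dest: fract_cong_imp_denom_coprime)
  have "fract_cong (x * v) (y * u) p"
    using xy uv by (blast intro: fract_cong_sym)
  then obtain w where w: "denom_coprime p w" "x * v - y * u = to_fr p * w"
    unfolding fract_cong_iff by blast
  have "x / u - y / v = (x * v - y * u) / u / v"
    using \<open>v \<noteq> 0\<close> coprime_fr_imp_nonzero[OF u] by (simp add: field_simps)
  also have "\<dots> = to_fr p * (w * to_fr E / u / to_fr (d * E - p * M))"
    unfolding w(2) unfolding v by simp
  finally show ?thesis
    using dc xy w cop u
    by (intro fract_congI[of _ _ "w * to_fr E / u / to_fr (d * E - p * M)"])
       (blast dest: fract_cong_imp_denom_coprime)+
qed

lemma fract_cong_0I: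
  assumes "p dvd N" "denom_coprime p z"
  shows "fract_cong (to_fr N * z) 0 p"
proof -
  from assms(1) obtain M where "N = p * M" ..
  with assms show ?thesis
    by (intro fract_congI[of _ _ "to_fr M * z"]) (auto simp: to_fr_simps)
qed

end

lemma denom_coprime_dvd:
  assumes "denom_coprime p x" "p' dvd p"
  shows "denom_coprime p' x"
  using assms unfolding denom_coprime_def by (blast intro: coprime_divisors dvd_refl)

text \<open>Any representation of the difference will do, even if \<open>D\<close> shares factors
  with \<open>p\<close>: comparison with a representation whose denominator \<open>E\<close> is
  coprime to \<open>p\<close> gives \<open>p dvd N * E\<close>.\<close>

lemma fract_cong_dvd_numerator:
  fixes p :: "'a::{idom, semiring_gcd}"
  assumes "fract_cong x y p" "x - y = to_fr N / to_fr D" "D \<noteq> 0"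
  shows "p dvd N"
proof -
  from assms(1) obtain M E where ME: "E \<noteq> 0" "coprime E p" "x - y = to_fr p * (to_fr M / to_fr E)"
    unfolding fract_cong_iff denom_coprime_iff by blast
  then have "to_fr (N * E) = to_fr (p * (M * D))"
    using assms by (simp add: to_fr_simps field_simps)
  then have "p dvd N * E"
    by simp
  with \<open>coprime E p\<close> show ?thesis
    by (simp add: coprime_commute coprime_dvd_mult_left_iff)
qed

text \<open>The Chinese remainder step: both moduli divide the numerator of one fixed
  representation, hence so does their product.\<close>

lemma fract_cong_mult_modulus:
  fixes p :: "'a::{idom, semiring_gcd}"
  assumes "fract_cong x y p" "fract_cong x y p'" "coprime p p'"
    and dc: "denom_coprime (p * p') x" "denom_coprime (p * p') y"
  shows "fract_cong x y (p * p')"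
proof -
  have "denom_coprime (p * p') (x - y)"
    using dc by blast
  then obtain N D where ND: "D \<noteq> 0" "coprime D (p * p')" "x - y = to_fr N / to_fr D"
    by (auto simp: denom_coprime_iff)
  then have "p * p' dvd N"
    using assms by (intro divides_mult) (auto intro: fract_cong_dvd_numerator)
  with ND dc show ?thesis
    unfolding fract_cong_def Fract_eq_to_fr by blast
qed

subsection \<open>The recurrence\<close>

text \<open>The summand is split by its dependence on \<open>a\<close> and \<open>b\<close>. In
  \<open>a_factor\<close> the inverses of \<open>a\<close> are cleared from numerator and
  denominator alike; in \<open>b_factor\<close> the power \<open>b ^ k\<close> is used up to turn
  \<open>1 - q ^ (4 * j + 1) / b\<close> into \<open>b - q ^ (4 * j + 1)\<close>.\<close>

definition weight :: "'a::field \<Rightarrow> nat \<Rightarrow> 'a" where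
  "weight q k = q ^ (k ^ 2 + k) * (\<Prod>j<k. (1 - q ^ (2 * j + 1)) / (1 - q ^ (4 * j + 4)))"

definition a_factor :: "'a::field \<Rightarrow> 'a \<Rightarrow> nat \<Rightarrow> 'a" where
  "a_factor q a k = (\<Prod>j<k. (1 - a * q ^ (2 * j + 1)) * (a - q ^ (2 * j + 1))
     / ((1 - a * q ^ (4 * j + 4)) * (a - q ^ (4 * j + 4))))"

definition b_factor :: "'a::field \<Rightarrow> 'a \<Rightarrow> nat \<Rightarrow> 'a" where
  "b_factor q b k = (\<Prod>j<k. (b - q ^ (4 * j + 1)) / (1 - b * q ^ (2 * j + 2)))"

definition quad_sum :: "'a::field \<Rightarrow> 'a \<Rightarrow> 'a \<Rightarrow> nat \<Rightarrow> 'a" where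
  "quad_sum q a b m =
     (\<Sum>k\<le>m. q_int q (6 * k + 1) * weight q k * a_factor q a k * b_factor q b k)"

text \<open>Replacing \<open>b\<close> by \<open>b * q ^ 4\<close> turns the numerator factor of
  index \<open>j + 1\<close> into \<open>q ^ 4\<close> times the old one of index \<open>j\<close>,
  and the denominator factor of index \<open>j\<close> into the old one of index
  \<open>j + 2\<close>. Hence \<open>Suc k\<close> is paired with \<open>k\<close>, and the extra
  factors are the ends of the two products.\<close>

lemma b_factor_shift:
  fixes q b :: "'a::field"
  assumes "\<And>j. b * q ^ (2 * j + 2) \<noteq> 1"
  shows "b_factor q (b * q ^ 4) (Suc k) * (1 - b * q ^ (2 * k + 2)) * (1 - b * q ^ (2 * k + 4))
      * (1 - b * q ^ (2 * k + 6))
    = b_factor q b k * (b * q ^ 4 - q) * q ^ (4 * k) * (1 - b * q ^ 2) * (1 - b * q ^ 4)"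
proof (induction k)
  case 0
  have "q ^ 4 * (q * q) = q ^ 6"
    by algebra
  then show ?case
    using assms[of 2] by (simp add: b_factor_def power2_eq_square mult.assoc)
next
  case (Suc k)
  have nz: "1 - b * q ^ (2 * k + 2) \<noteq> 0" "1 - b * q ^ (2 * k + 8) \<noteq> 0"
    using assms[of k] assms[of "k + 3"] by (simp_all add: algebra_simps)
  have "b * q ^ 4 - q ^ (4 * Suc k + 1) = q ^ 4 * (b - q ^ (4 * k + 1))"
    using power_add[of q "4 * k + 1" 4] by (simp add: algebra_simps)
  moreover have "b * q ^ 4 * q ^ (2 * Suc k + 2) = b * q ^ (2 * k + 8)"
    using power_add[of q 4 "2 * Suc k + 2"] by (simp add: mult.assoc add.commute)
  ultimately have s: "b_factor q (b * q ^ 4) (Suc (Suc k))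
    = b_factor q (b * q ^ 4) (Suc k) * (q ^ 4 * (b - q ^ (4 * k + 1)) / (1 - b * q ^ (2 * k + 8)))"
    unfolding b_factor_def by (subst prod.lessThan_Suc) metis
  have e: "2 * Suc k + c = 2 * k + (c + 2)" for c
    by simp
  have "b_factor q (b * q ^ 4) (Suc (Suc k)) * (1 - b * q ^ (2 * Suc k + 2)) * (1 - b * q ^ (2 * Suc k + 4))
      * (1 - b * q ^ (2 * Suc k + 6))
    = (b_factor q (b * q ^ 4) (Suc k) * (1 - b * q ^ (2 * k + 2)) * (1 - b * q ^ (2 * k + 4)) * (1 - b * q ^ (2 * k + 6)))
        * (q ^ 4 * (b - q ^ (4 * k + 1)) / (1 - b * q ^ (2 * k + 2)))"
    unfolding s e using nz by simp
  also have "\<dots> = b_factor q b (Suc k) * (b * q ^ 4 - q) * q ^ (4 * Suc k) * (1 - b * q ^ 2) * (1 - b * q ^ 4)"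
  proof -
    have "b_factor q b (Suc k) = b_factor q b k * ((b - q ^ (4 * k + 1)) / (1 - b * q ^ (2 * k + 2)))"
      unfolding b_factor_def by simp
    moreover have "q ^ (4 * Suc k) = q ^ 4 * q ^ (4 * k)"
      by (simp flip: power_add)
    ultimately show ?thesis
      unfolding Suc.IH by simp
  qed
  finally show ?case .
qed

text \<open>The right-hand side is the last term of a telescoping sum, whose general term is found by
  \<open>q\<close>-Gosper summation. The left-hand side is multiplied by \<open>a\<close> to avoid \<open>1 / a\<close>.\<close>

lemma quad_sum_recurrence:
  fixes q a b :: "'a::field"
  assumes q: "q \<noteq> 0" "q \<noteq> 1" "\<And>j. q ^ (4 * j + 4) \<noteq> 1"
    and a: "\<And>j. a * q ^ (4 * j + 4) \<noteq> 1" "\<And>j. a \<noteq> q ^ (4 * j + 4)"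
    and b: "\<And>j. b * q ^ (2 * j + 2) \<noteq> 1"
  shows "(1 - a * b * q ^ 3) * (a - b * q ^ 3) * quad_sum q a (b * q ^ 4) m
       - a * (1 - b * q ^ 2) * (1 - b * q ^ 4) * quad_sum q a b m
     = (1 - q ^ (2 * m + 1)) / (1 - q) * weight q m
       * (a_factor q a m * (1 - a * q ^ (2 * m + 1)) * (a - q ^ (2 * m + 1)))
       * (b_factor q b m * b * q ^ (2 * m + 2) * (1 - b * q ^ 2) * (1 - b * q ^ 4)
           / ((1 - b * q ^ (2 * m + 2)) * (1 - b * q ^ (2 * m + 4))))"
proof (induction m)
  case 0
  have "(1 - a * b * q ^ 3) * (a - b * q ^ 3) - a * (1 - b * q ^ 2) * (1 - b * q ^ 4)
    = (1 - a * q) * (a - q) * (b * q ^ 2)"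
    by algebra
  moreover have "1 - b * q ^ 2 \<noteq> 0" "1 - b * q ^ 4 \<noteq> 0"
    using b[of 0] b[of 1] by (simp_all add: power2_eq_square)
  ultimately show ?case
    using q by (simp add: quad_sum_def weight_def a_factor_def b_factor_def q_int_def flip: power2_eq_square)
next
  case (Suc m)
  \<comment> \<open>Outside \<open>W\<close>, \<open>A\<close>, \<open>B\<close> all powers are
    monomials in \<open>q\<close> and \<open>y\<close>, so the induction step becomes a polynomial
    identity in \<open>q\<close>, \<open>a\<close>, \<open>b\<close>, \<open>y\<close>.\<close>
  define y where "y = q ^ (2 * m + 2)"
  define W A B where "W = weight q m" and "A = a_factor q a m" and "B = b_factor q b m"
  define U V where "U = (1 - a * b * q ^ 3) * (a - b * q ^ 3)"
    and "V = (1 - b * q ^ 2) * (1 - b * q ^ 4)"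
  have qm: "q ^ (2 * m + 1) = y / q" "q ^ (4 * m + 4) = y ^ 2" "q ^ (4 * m + 1) = y ^ 2 / q ^ 3"
    "q ^ (2 * m + 4) = y * q ^ 2" "q ^ (2 * m + 6) = y * q ^ 4" "q ^ (4 * m) = y ^ 2 / q ^ 4"
    "q ^ (2 * Suc m + 1) = y * q" "q ^ (2 * Suc m + 2) = y * q ^ 2" "q ^ (2 * Suc m + 4) = y * q ^ 4"
    "q ^ (6 * Suc m + 1) = q * y ^ 3"
  proof -
    define t where "t = q ^ m"
    have t: "q ^ (c * m) = t ^ c" for c
      by (simp add: t_def mult.commute flip: power_mult)
    have y: "y = t ^ 2 * q ^ 2"
      unfolding y_def power_add t ..
    have Suc: "2 * Suc m + c = 2 * m + (c + 2)" "6 * Suc m + c = 6 * m + (c + 6)" for c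
      by simp_all
    show "q ^ (2 * m + 1) = y / q" "q ^ (4 * m + 4) = y ^ 2" "q ^ (4 * m + 1) = y ^ 2 / q ^ 3"
      "q ^ (2 * m + 4) = y * q ^ 2" "q ^ (2 * m + 6) = y * q ^ 4" "q ^ (4 * m) = y ^ 2 / q ^ 4"
      "q ^ (2 * Suc m + 1) = y * q" "q ^ (2 * Suc m + 2) = y * q ^ 2" "q ^ (2 * Suc m + 4) = y * q ^ 4"
      "q ^ (6 * Suc m + 1) = q * y ^ 3"
      unfolding Suc y power_add t using q(1)
      by (simp_all add: power_mult_distrib flip: power_mult)
        (simp_all add: eval_nat_numeral)
  qed
  have qm': "q ^ ((Suc m)\<^sup>2 + Suc m) = q ^ (m\<^sup>2 + m) * y"
  proof -
    have "(Suc m)\<^sup>2 + Suc m = (m\<^sup>2 + m) + (2 * m + 2)"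
      by (simp add: power2_eq_square)
    then show ?thesis
      unfolding y_def power_add[symmetric] by simp
  qed
  have nz: "1 - y ^ 2 \<noteq> 0" "1 - a * y ^ 2 \<noteq> 0" "a - y ^ 2 \<noteq> 0" "1 - b * y \<noteq> 0"
    "1 - b * y * q ^ 2 \<noteq> 0" "1 - b * y * q ^ 4 \<noteq> 0"
  proof -
    have "2 * (m + 2) + 2 = 2 * m + 6"
      by simp
    then have "b * (y * q ^ 4) \<noteq> 1"
      using b[of "m + 2"] qm by metis
    then show "1 - y ^ 2 \<noteq> 0" "1 - a * y ^ 2 \<noteq> 0" "a - y ^ 2 \<noteq> 0" "1 - b * y \<noteq> 0"
      "1 - b * y * q ^ 2 \<noteq> 0" "1 - b * y * q ^ 4 \<noteq> 0"
      using q(3)[of m, unfolded qm] a(1)[of m, unfolded qm] a(2)[of m, unfolded qm]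
        b[of m, folded y_def] b[of "Suc m", unfolded qm]
      by (simp_all add: mult.assoc)
  qed
  have W': "weight q (Suc m) = W * y * ((1 - y / q) / (1 - y ^ 2))"
    unfolding weight_def prod.lessThan_Suc qm qm' W_def by (simp only: mult_ac)
  have A': "a_factor q a (Suc m) = A * ((1 - a * (y / q)) * (a - y / q) / ((1 - a * y ^ 2) * (a - y ^ 2)))"
    unfolding a_factor_def prod.lessThan_Suc qm A_def ..
  have B': "b_factor q b (Suc m) = B * ((b - y ^ 2 / q ^ 3) / (1 - b * y))"
    unfolding b_factor_def prod.lessThan_Suc qm B_def y_def[symmetric] ..
  have B'': "b_factor q (b * q ^ 4) (Suc m) = B * (b * q ^ 4 - q) * (y ^ 2 / q ^ 4) * V
      / ((1 - b * y) * (1 - b * y * q ^ 2) * (1 - b * y * q ^ 4))"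
    using b_factor_shift[OF b, of m, folded y_def, unfolded qm] nz unfolding B_def V_def
    by (subst nonzero_eq_divide_eq) (simp_all add: mult_ac)
  define p\<^sub>1 p\<^sub>2 p\<^sub>3 where p_def: "p\<^sub>1 = 1 - y / q" "p\<^sub>2 = 1 - a * (y / q)" "p\<^sub>3 = a - y / q"
  define d\<^sub>1 d\<^sub>2 d\<^sub>3 e\<^sub>1 e\<^sub>2 e\<^sub>3 where d_def: "d\<^sub>1 = 1 - y ^ 2" "d\<^sub>2 = 1 - a * y ^ 2" "d\<^sub>3 = a - y ^ 2"
    "e\<^sub>1 = 1 - b * y" "e\<^sub>2 = 1 - b * y * q ^ 2" "e\<^sub>3 = 1 - b * y * q ^ 4"
  \<comment> \<open>\<open>K\<close> is the common factor of the four quantities in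
    \<open>e1\<close> to \<open>e4\<close>. What is left of them is polynomial and is compared by
    \<open>algebra\<close> after \<open>e4\<close>.\<close>
  define K where "K = W * A * B * V * p\<^sub>1 * p\<^sub>2 * p\<^sub>3 * y / (q ^ 3 * (1 - q) * d\<^sub>1 * d\<^sub>2 * d\<^sub>3 * e\<^sub>1 * e\<^sub>2 * e\<^sub>3)"
  define T T' where "T = q_int q (6 * Suc m + 1) * weight q (Suc m) * a_factor q a (Suc m) * b_factor q b (Suc m)"
    and "T' = q_int q (6 * Suc m + 1) * weight q (Suc m) * a_factor q a (Suc m) * b_factor q (b * q ^ 4) (Suc m)"
  have nz': "d\<^sub>1 \<noteq> 0" "d\<^sub>2 \<noteq> 0" "d\<^sub>3 \<noteq> 0" "e\<^sub>1 \<noteq> 0" "e\<^sub>2 \<noteq> 0" "e\<^sub>3 \<noteq> 0" "1 - q \<noteq> 0" "q \<noteq> 0"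
    using nz q by (simp_all add: d_def)
  have bq: "b - y ^ 2 / q ^ 3 = (b * q ^ 3 - y ^ 2) / q ^ 3"
    "(b * q ^ 4 - q) * (y ^ 2 / q ^ 4) = (b * q ^ 3 - 1) * y ^ 2 / q ^ 3"
    using q(1) by (simp_all add: field_simps) (simp_all add: eval_nat_numeral algebra_simps)
  have e1: "U * T' = K * ((1 - q * y ^ 3) * U * y ^ 2 * (b * q ^ 3 - 1))"
    unfolding T'_def W' A' B'' q_int_def qm K_def mult.assoc[of B] bq d_def[symmetric] p_def[symmetric]
    using nz' by (simp add: divide_simps)
  have e2: "a * V * T = K * ((1 - q * y ^ 3) * a * (b * q ^ 3 - y ^ 2) * e\<^sub>2 * e\<^sub>3)"
    unfolding T_def W' A' B' q_int_def qm K_def bq d_def[symmetric] p_def[symmetric]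
    using nz' by (simp add: divide_simps)
  have e3: "(1 - q ^ (2 * m + 1)) / (1 - q) * weight q m
       * (a_factor q a m * (1 - a * q ^ (2 * m + 1)) * (a - q ^ (2 * m + 1)))
       * (b_factor q b m * b * q ^ (2 * m + 2) * (1 - b * q ^ 2) * (1 - b * q ^ 4)
           / ((1 - b * q ^ (2 * m + 2)) * (1 - b * q ^ (2 * m + 4))))
      = K * (b * q ^ 3 * e\<^sub>3 * d\<^sub>1 * d\<^sub>3 * d\<^sub>2)" (is "?H = _")
    unfolding y_def[symmetric] qm W_def[symmetric] A_def[symmetric] B_def[symmetric] K_def V_def d_def[symmetric]
      p_def[symmetric] mult.assoc[of b y, symmetric]
    using nz' by (simp add: divide_simps)
  have e4: "(1 - q ^ (2 * Suc m + 1)) / (1 - q) * weight q (Suc m)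
       * (a_factor q a (Suc m) * (1 - a * q ^ (2 * Suc m + 1)) * (a - q ^ (2 * Suc m + 1)))
       * (b_factor q b (Suc m) * b * q ^ (2 * Suc m + 2) * (1 - b * q ^ 2) * (1 - b * q ^ 4)
           / ((1 - b * q ^ (2 * Suc m + 2)) * (1 - b * q ^ (2 * Suc m + 4))))
      = K * ((b * q ^ 3 - y ^ 2) * (1 - q * y) * (1 - a * q * y) * (a - q * y) * b * q ^ 2 * y)" (is "?H' = _")
    unfolding qm W' A' B' bq K_def V_def d_def[symmetric] mult.assoc[of b y, symmetric]
      p_def[symmetric]
    using nz' by (simp add: divide_simps mult_ac)
  have "b * q ^ 3 * e\<^sub>3 * d\<^sub>1 * d\<^sub>3 * d\<^sub>2 + (1 - q * y ^ 3) * U * y ^ 2 * (b * q ^ 3 - 1)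
      - (1 - q * y ^ 3) * a * (b * q ^ 3 - y ^ 2) * e\<^sub>2 * e\<^sub>3
    = (b * q ^ 3 - y ^ 2) * (1 - q * y) * (1 - a * q * y) * (a - q * y) * b * q ^ 2 * y"
    unfolding d_def U_def by algebra
  then have "?H + U * T' - a * V * T = ?H'"
    unfolding e1 e2 e3 e4 distrib_left[symmetric] right_diff_distrib[symmetric] by (rule arg_cong)
  moreover have "U * quad_sum q a (b * q ^ 4) m - a * V * quad_sum q a b m = ?H"
    using Suc.IH by (simp add: U_def V_def mult.assoc)
  moreover have "quad_sum q a (b * q ^ 4) (Suc m) = quad_sum q a (b * q ^ 4) m + T'"
    "quad_sum q a b (Suc m) = quad_sum q a b m + T"
    unfolding quad_sum_def T_def T'_def by simp_all
  moreover have "u * S' - v * S = z"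
    if "x + u * t' - v * t = z" "u * s' - v * s = x" "S' = s' + t'" "S = s + t"
    for x z u v s s' t t' S S' :: 'a
    using that by (auto simp: algebra_simps)
  ultimately have "U * quad_sum q a (b * q ^ 4) (Suc m) - a * V * quad_sum q a b (Suc m) = ?H'"
    by blast
  then show ?case
    by (simp only: U_def V_def mult.assoc)
qed

subsection \<open>Closed forms\<close>

text \<open>This is the part of the inhomogeneous term that depends on \<open>a\<close> alone.
  \<open>a_factor q a m\<close> stops at index \<open>m - 1\<close> and the last two factors supply
  index \<open>m\<close>, so a zero at \<open>l = m\<close> still counts.\<close>

lemma a_factor_eq_0:
  assumes "a = q ^ (2 * l + 1) \<or> a * q ^ (2 * l + 1) = 1" "l \<le> m"
  shows "a_factor q a m * (1 - a * q ^ (2 * m + 1)) * (a - q ^ (2 * m + 1)) = 0"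
proof (cases "l = m")
  case False
  with assms have "a_factor q a m = 0"
    unfolding a_factor_def by (intro prod_zero bexI[of _ l]) auto
  then show ?thesis by simp
qed (use assms in auto)

text \<open>The values of \<open>quad_sum q a b m\<close> at \<open>a = q ^ n\<close> or \<open>1 / q ^ n\<close>, and at \<open>b = q ^ n\<close>, for \<open>n = 4 N + 1\<close>.\<close>

definition a_value :: "'a::field \<Rightarrow> 'a \<Rightarrow> nat \<Rightarrow> 'a" where
  "a_value q b N = q_int q (4 * N + 1) * (\<Prod>i<N. (b - q ^ (4 * i + 2)) / (q * (1 - b * q ^ (4 * i + 4))))"

definition b_value :: "'a::field \<Rightarrow> 'a \<Rightarrow> nat \<Rightarrow> 'a" where
  "b_value q a N = (\<Prod>i<N. a * (1 - q ^ (4 * i + 3)) * (1 - q ^ (4 * i + 5))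
     / ((1 - a * q ^ (4 * i + 4)) * (a - q ^ (4 * i + 4))))"

section \<open>Evaluations when \<open>q\<close> is not a root of unity\<close>

context
  fixes q :: "'a::field"
  assumes q_nonzero: "q \<noteq> 0" and q_power: "\<And>i. i > 0 \<Longrightarrow> q ^ i \<noteq> 1"
begin

lemma q_power_eq_iff: "q ^ i = q ^ j \<longleftrightarrow> i = j"
proof (induction i j rule: linorder_wlog)
  case (le i j)
  then show ?case
    using q_power[of "j - i"] q_nonzero power_add[of q i "j - i"] by (cases "i = j") auto
qed auto

lemma q_power_mult_neq_1: "i > 0 \<Longrightarrow> q ^ i * q ^ j \<noteq> 1"
  unfolding power_add[symmetric] by (rule q_power) simp

lemma quad_sum_base: "quad_sum q a q m = 1"
proof -
  have "b_factor q q k = 0" if "k > 0" for k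
    unfolding b_factor_def using that by (intro prod_zero bexI[of _ 0]) auto
  then have "quad_sum q a q m
    = (\<Sum>k\<le>m. if k = 0 then q_int q (6 * k + 1) * weight q k * a_factor q a k * b_factor q q k else 0)"
    unfolding quad_sum_def by (intro sum.cong) auto
  then show ?thesis
    using q_power[of 1] by (simp add: weight_def a_factor_def b_factor_def q_int_def)
qed

lemma quad_sum_recurrence_0:
  assumes a: "\<And>j. a * q ^ (4 * j + 4) \<noteq> 1" "\<And>j. a \<noteq> q ^ (4 * j + 4)"
    and b: "\<And>j. b * q ^ (2 * j + 2) \<noteq> 1"
    and "a_factor q a m * (1 - a * q ^ (2 * m + 1)) * (a - q ^ (2 * m + 1)) = 0 \<or> b_factor q b m = 0"
  shows "(1 - a * b * q ^ 3) * (a - b * q ^ 3) * quad_sum q a (b * q ^ 4) m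
       = a * (1 - b * q ^ 2) * (1 - b * q ^ 4) * quad_sum q a b m"
proof -
  have "q \<noteq> 1" "q ^ (4 * j + 4) \<noteq> 1" for j
    using q_power[of 1] q_power[of "4 * j + 4"] by (auto simp del: power_Suc)
  note rec = quad_sum_recurrence[OF q_nonzero this a b, of m]
  have "(1 - a * b * q ^ 3) * (a - b * q ^ 3) * quad_sum q a (b * q ^ 4) m
       - a * (1 - b * q ^ 2) * (1 - b * q ^ 4) * quad_sum q a b m = 0"
    unfolding rec using assms(4) by (elim disjE) (simp_all only: mult_zero_left mult_zero_right div_0)
  then show ?thesis by simp
qed

lemma quad_sum_eq_b_value:
  assumes a: "\<And>j. a * q ^ (4 * j + 4) \<noteq> 1" "\<And>j. a \<noteq> q ^ (4 * j + 4)"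
    and "N \<le> m"
  shows "quad_sum q a (q ^ (4 * N + 1)) m = b_value q a N"
  using \<open>N \<le> m\<close>
proof (induction N)
  case 0
  then show ?case
    by (simp add: quad_sum_base b_value_def)
next
  case (Suc N)
  \<comment> \<open>The zero factor has index \<open>N < m\<close>. The recurrence is thus
    homogeneous in every step up to and including the one that reaches index
    \<open>m\<close>.\<close>
  have "b_factor q (q ^ (4 * N + 1)) m = 0"
    unfolding b_factor_def using Suc.prems by (intro prod_zero bexI[of _ N]) auto
  then have "(1 - a * q ^ (4 * N + 1) * q ^ 3) * (a - q ^ (4 * N + 1) * q ^ 3)
        * quad_sum q a (q ^ (4 * N + 1) * q ^ 4) m
      = a * (1 - q ^ (4 * N + 1) * q ^ 2) * (1 - q ^ (4 * N + 1) * q ^ 4) * quad_sum q a (q ^ (4 * N + 1)) m"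
    by (intro quad_sum_recurrence_0 a q_power_mult_neq_1) auto
  moreover have e: "q ^ (4 * N + 1) * q ^ 2 = q ^ (4 * N + 3)" "q ^ (4 * N + 1) * q ^ 3 = q ^ (4 * N + 4)"
    "q ^ (4 * N + 1) * q ^ 4 = q ^ (4 * N + 5)" "q ^ (4 * Suc N + 1) = q ^ (4 * N + 5)"
    unfolding power_add[symmetric] by (rule arg_cong[of _ _ "power q"], simp)+
  moreover have "1 - a * q ^ (4 * N + 4) \<noteq> 0" "a - q ^ (4 * N + 4) \<noteq> 0"
    using a[of N] by auto
  moreover have "quad_sum q a (q ^ (4 * N + 1)) m = b_value q a N"
    using Suc by simp
  moreover have "b_value q a (Suc N) = b_value q a N * (a * (1 - q ^ (4 * N + 3)) * (1 - q ^ (4 * N + 5))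
     / ((1 - a * q ^ (4 * N + 4)) * (a - q ^ (4 * N + 4))))"
    unfolding b_value_def prod.lessThan_Suc ..
  moreover have "x = y * (c / (u * v))" if "u * v * x = c * y" "u \<noteq> 0" "v \<noteq> 0" for x y c u v :: 'a
    using that by (simp add: field_simps)
  ultimately show ?case
    unfolding mult.assoc[of a] by simp
qed

text \<open>The product telescopes to the inverse of \<open>[4 N + 1]\<close>; the leading
  \<open>q_int\<close> in \<open>a_value\<close> is the normalisation that matches
  \<open>quad_sum_base\<close>.\<close>

lemma a_value_base: "a_value q q N = 1"
proof -
  have "(\<Prod>i<N. (q - q ^ (4 * i + 2)) / (q * (1 - q * q ^ (4 * i + 4)))) = (1 - q) / (1 - q ^ (4 * N + 1))"
  proof (induction N)
    case 0
    then show ?case using q_power[of 1] by simp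
  next
    case (Suc N)
    have "(q - q ^ (4 * N + 2)) / (q * (1 - q * q ^ (4 * N + 4))) = (1 - q ^ (4 * N + 1)) / (1 - q ^ (4 * Suc N + 1))"
      using q_nonzero q_power[of "4 * N + 5"] by (simp add: field_simps eval_nat_numeral)
    then show ?case
      using Suc.IH q_power[of "4 * N + 1"] by simp
  qed
  then show ?thesis
    unfolding a_value_def q_int_def using q_power[of 1] q_power[of "4 * N + 1"] by simp
qed

text \<open>This is the homogeneous recurrence of \<open>quad_sum\<close> at
  \<open>a = q ^ (4 * N + 1)\<close>. In the induction the exponent of this value grows together
  with the number of factors, and the new factors of the two products compensate exactly for the
  change of the coefficients.\<close>

lemma a_value_recurrence:
  assumes "\<And>j. b * q ^ (2 * j + 2) \<noteq> 1"
  shows "(1 - q ^ (4 * N + 1) * b * q ^ 3) * (q ^ (4 * N + 1) - b * q ^ 3) * a_value q (b * q ^ 4) N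
       = q ^ (4 * N + 1) * (1 - b * q ^ 2) * (1 - b * q ^ 4) * a_value q b N"
proof -
  define r where "r b n = (\<Prod>i<n. (b - q ^ (4 * i + 2)) / (q * (1 - b * q ^ (4 * i + 4))))" for b n
  have "(1 - q ^ (4 * n + 1) * b * q ^ 3) * (q ^ (4 * n + 1) - b * q ^ 3) * r (b * q ^ 4) n
       = q ^ (4 * n + 1) * (1 - b * q ^ 2) * (1 - b * q ^ 4) * r b n" for n
  proof (induction n)
    case 0
    show ?case
      by (simp add: r_def) algebra
  next
    case (Suc n)
    define x where "x = q ^ (4 * n + 1)"
    have "x * q ^ 3 = q ^ (2 * (2 * n + 1) + 2)" "x * q ^ 7 = q ^ (2 * (2 * n + 3) + 2)"
      unfolding x_def power_add[symmetric] by (rule arg_cong[of _ _ "power q"], simp)+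
    then have nz: "1 - b * (x * q ^ 3) \<noteq> 0" "1 - b * (x * q ^ 7) \<noteq> 0"
      using assms by (metis right_minus_eq)+
    have pw: "q ^ (4 * n + 2) = x * q" "q ^ (4 * n + 4) = x * q ^ 3" "q ^ (4 * Suc n + 1) = x * q ^ 4"
      unfolding x_def power_Suc2[symmetric] power_add[symmetric] by (rule arg_cong[of _ _ "power q"], simp)+
    have "r (b * q ^ 4) (Suc n) = r (b * q ^ 4) n * ((b * q ^ 4 - x * q) / (q * (1 - b * q ^ 4 * (x * q ^ 3))))"
      "r b (Suc n) = r b n * ((b - x * q) / (q * (1 - b * (x * q ^ 3))))"
      unfolding r_def prod.lessThan_Suc pw by (rule refl)+
    moreover have "(b * q ^ 4 - x * q) / (q * (1 - b * q ^ 4 * (x * q ^ 3))) = (b * q ^ 3 - x) / (1 - b * (x * q ^ 7))"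
    proof -
      have "b * q ^ 4 - x * q = q * (b * q ^ 3 - x)" "b * q ^ 4 * (x * q ^ 3) = b * (x * q ^ 7)"
        by algebra+
      then show ?thesis using q_nonzero by simp
    qed
    ultimately have r': "r (b * q ^ 4) (Suc n) * (1 - b * (x * q ^ 7)) = r (b * q ^ 4) n * (b * q ^ 3 - x)"
      "r b n * (b - x * q) = r b (Suc n) * q * (1 - b * (x * q ^ 3))"
      using nz q_nonzero by simp_all
    have "(1 - b * (x * q ^ 3)) * ((1 - x * q ^ 4 * b * q ^ 3) * (x * q ^ 4 - b * q ^ 3) * r (b * q ^ 4) (Suc n))
      = (1 - b * (x * q ^ 3)) * (x * q ^ 4 * (1 - b * q ^ 2) * (1 - b * q ^ 4) * r b (Suc n))"
      using r' Suc.IH[folded x_def] by algebra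
    then show ?case
      unfolding pw using nz by simp
  qed
  from this[of N] show ?thesis
    unfolding a_value_def r_def[symmetric]
    by (simp only: mult.left_commute[of _ "q_int q (4 * N + 1)"])
qed

text \<open>Clearing denominators gives one polynomial \<open>P\<close> for all admissible
  \<open>b\<close>, so agreement at infinitely many points will suffice. At a zero of a denominator
  the quotient is 0 by convention and the identity may fail.\<close>

lemma quad_sum_poly:
  "\<exists>P. \<forall>b. (\<forall>j. b * q ^ (2 * j + 2) \<noteq> 1) \<longrightarrow>
     quad_sum q a b m * (\<Prod>j<m. 1 - b * q ^ (2 * j + 2)) = poly P b"
proof (induction m)
  case 0
  show ?case
    \<comment> \<open>For \<open>m = 0\<close> the sum does not depend on \<open>b\<close>, so it is
      read off at \<open>b = 0\<close>.\<close>
    by (rule exI[of _ "[:quad_sum q a 0 0:]"]) (simp add: quad_sum_def b_factor_def)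
next
  case (Suc m)
  then obtain P where P: "\<And>b. (\<forall>j. b * q ^ (2 * j + 2) \<noteq> 1) \<Longrightarrow>
    quad_sum q a b m * (\<Prod>j<m. 1 - b * q ^ (2 * j + 2)) = poly P b" by blast
  define c where "c = q_int q (6 * Suc m + 1) * weight q (Suc m) * a_factor q a (Suc m)"
  show ?case
  proof (rule exI[of _ "P * [:1, - (q ^ (2 * m + 2)):] + smult c (\<Prod>j<Suc m. [:- (q ^ (4 * j + 1)), 1:])"],
      intro allI impI)
    fix b assume b: "\<forall>j. b * q ^ (2 * j + 2) \<noteq> 1"
    define D where "D n = (\<Prod>j<n. 1 - b * q ^ (2 * j + 2))" for n
    have "b_factor q b (Suc m) * D (Suc m) = (\<Prod>j<Suc m. b - q ^ (4 * j + 1))"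
      unfolding b_factor_def D_def prod.distrib[symmetric] using b by (intro prod.cong) auto
    moreover have "quad_sum q a b (Suc m) = quad_sum q a b m + c * b_factor q b (Suc m)"
      by (simp add: quad_sum_def c_def)
    moreover have "D (Suc m) = D m * (1 - b * q ^ (2 * m + 2))"
      by (simp add: D_def)
    ultimately have "quad_sum q a b (Suc m) * D (Suc m)
      = (quad_sum q a b m * D m) * (1 - b * q ^ (2 * m + 2)) + c * (\<Prod>j<Suc m. b - q ^ (4 * j + 1))"
      by (metis distrib_right mult.assoc)
    also have "quad_sum q a b m * D m = poly P b"
      using P b by (simp add: D_def)
    finally show "quad_sum q a b (Suc m) * (\<Prod>j<Suc m. 1 - b * q ^ (2 * j + 2))
      = poly (P * [:1, - (q ^ (2 * m + 2)):] + smult c (\<Prod>j<Suc m. [:- (q ^ (4 * j + 1)), 1:])) b"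
      by (simp add: D_def poly_prod algebra_simps)
  qed
qed

lemma a_value_poly:
  "\<exists>P. \<forall>b. (\<forall>j. b * q ^ (2 * j + 2) \<noteq> 1) \<longrightarrow>
     a_value q b N * (\<Prod>i<N. q * (1 - b * q ^ (4 * i + 4))) = poly P b"
proof (rule exI[of _ "smult (q_int q (4 * N + 1)) (\<Prod>i<N. [:- (q ^ (4 * i + 2)), 1:])"], intro allI impI)
  fix b assume b: "\<forall>j. b * q ^ (2 * j + 2) \<noteq> 1"
  have "2 * (2 * i + 1) + 2 = 4 * i + (4::nat)" for i
    by simp
  then have "b * q ^ (4 * i + 4) \<noteq> 1" for i
    using b by metis
  then have "(\<Prod>i<N. (b - q ^ (4 * i + 2)) / (q * (1 - b * q ^ (4 * i + 4)))) * (\<Prod>i<N. q * (1 - b * q ^ (4 * i + 4)))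
    = (\<Prod>i<N. b - q ^ (4 * i + 2))"
    unfolding prod.distrib[symmetric] using q_nonzero by (intro prod.cong) auto
  then show "a_value q b N * (\<Prod>i<N. q * (1 - b * q ^ (4 * i + 4)))
    = poly (smult (q_int q (4 * N + 1)) (\<Prod>i<N. [:- (q ^ (4 * i + 2)), 1:])) b"
    by (simp add: a_value_def poly_prod mult.assoc)
qed

lemma quad_sum_eq_a_value:
  assumes a: "a = q ^ (4 * N + 1) \<or> a = 1 / q ^ (4 * N + 1)" and m: "2 * N \<le> m"
    and b: "\<And>j. b * q ^ (2 * j + 2) \<noteq> 1"
  shows "quad_sum q a b m = a_value q b N"
proof -
  have odd: "4 * N + 1 \<noteq> 4 * j + (4::nat)" for j
    by presburger
  have a': "a * q ^ (4 * j + 4) \<noteq> 1" "a \<noteq> q ^ (4 * j + 4)" for j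
  proof -
    have "q ^ (4 * N + 1) * q ^ (4 * j + 4) \<noteq> 1" "q ^ (4 * N + 1) \<noteq> q ^ (4 * j + 4)"
      by (rule q_power_mult_neq_1, simp) (simp only: q_power_eq_iff odd not_False_eq_True)
    moreover have "q ^ (4 * N + 1) \<noteq> 0"
      using q_nonzero by simp
    moreover define Q x where "Q = q ^ (4 * N + 1)" and "x = q ^ (4 * j + 4)"
    ultimately have "Q * x \<noteq> 1" "Q \<noteq> x" "Q \<noteq> 0" "a = Q \<or> a = 1 / Q"
      using a by simp_all
    then show "a * q ^ (4 * j + 4) \<noteq> 1" "a \<noteq> q ^ (4 * j + 4)"
      unfolding x_def[symmetric] by (auto simp: divide_eq_eq mult.commute)
  qed
  \<comment> \<open>The index \<open>l = 2 * N\<close> satisfies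
    \<open>2 * l + 1 = 4 * N + 1\<close>; this is where the bound \<open>2 * N \<le> m\<close>
    enters.\<close>
  have zero: "a_factor q a m * (1 - a * q ^ (2 * m + 1)) * (a - q ^ (2 * m + 1)) = 0"
    by (rule a_factor_eq_0[where l = "2 * N"]) (use a m q_nonzero in auto)
  have at: "quad_sum q a (q ^ (4 * j + 1)) m = a_value q (q ^ (4 * j + 1)) N" for j
  proof (induction j)
    case 0
    show ?case by (simp add: quad_sum_base a_value_base)
  next
    case (Suc j)
    define Q c where "Q = q ^ (4 * N + 1)" and "c = q ^ (4 * j + 1)"
    have "Q \<noteq> 0" using q_nonzero by (simp add: Q_def)
    have c: "c * q ^ (2 * i + 2) \<noteq> 1" for i
      unfolding c_def by (rule q_power_mult_neq_1) simp
    have "(1 - a * c * q ^ 3) * (a - c * q ^ 3) * quad_sum q a (c * q ^ 4) m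
       = a * (1 - c * q ^ 2) * (1 - c * q ^ 4) * quad_sum q a c m"
      using a' c zero by (intro quad_sum_recurrence_0) auto
    moreover have "(1 - Q * c * q ^ 3) * (Q - c * q ^ 3) * a_value q (c * q ^ 4) N
       = Q * (1 - c * q ^ 2) * (1 - c * q ^ 4) * a_value q c N"
      unfolding Q_def by (rule a_value_recurrence[OF c])
    then have "(1 - a * c * q ^ 3) * (a - c * q ^ 3) * a_value q (c * q ^ 4) N
       = a * (1 - c * q ^ 2) * (1 - c * q ^ 4) * a_value q c N"
      using a
    proof (elim disjE)
      assume *: "(1 - Q * c * q ^ 3) * (Q - c * q ^ 3) * a_value q (c * q ^ 4) N
       = Q * (1 - c * q ^ 2) * (1 - c * q ^ 4) * a_value q c N" and "a = 1 / q ^ (4 * N + 1)"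
      \<comment> \<open>Dividing the recurrence by \<open>Q ^ 2\<close> replaces \<open>Q\<close> by
        \<open>1 / Q\<close>: it is invariant under inversion of \<open>a\<close>.\<close>
      then have "a * Q = 1"
        using \<open>Q \<noteq> 0\<close> by (simp add: Q_def)
      with * show ?thesis by algebra
    qed (simp add: Q_def)
    \<comment> \<open>\<open>a\<close> is an odd power of \<open>q\<close> or the inverse of one,
      whereas \<open>c * q ^ 3\<close> is an even power. So neither their product is 1 nor are they
      equal, and the left coefficient can be cancelled.\<close>
    moreover have "c * q ^ 3 = q ^ (4 * j + 4)"
      unfolding c_def power_add[symmetric] by (rule arg_cong[of _ _ "power q"]) simp
    then have "1 - a * c * q ^ 3 \<noteq> 0" "a - c * q ^ 3 \<noteq> 0"
      using a'[of j] by (simp_all add: mult.assoc)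
    ultimately have "quad_sum q a (c * q ^ 4) m = a_value q (c * q ^ 4) N"
      using Suc.IH[folded c_def] by (metis mult_eq_0_iff mult_left_cancel)
    moreover have "c * q ^ 4 = q ^ (4 * Suc j + 1)"
      unfolding c_def power_add[symmetric] by (rule arg_cong[of _ _ "power q"]) simp
    ultimately show ?case by simp
  qed
  define D where "D = (\<lambda>b. \<Prod>j<m. 1 - b * q ^ (2 * j + 2))"
  define E where "E = (\<lambda>b. \<Prod>i<N. q * (1 - b * q ^ (4 * i + 4)))"
  obtain P R where P: "\<And>b. (\<forall>j. b * q ^ (2 * j + 2) \<noteq> 1) \<Longrightarrow> quad_sum q a b m * D b = poly P b"
    and R: "\<And>b. (\<forall>j. b * q ^ (2 * j + 2) \<noteq> 1) \<Longrightarrow> a_value q b N * E b = poly R b"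
    using quad_sum_poly[of a m] a_value_poly[of N] unfolding D_def E_def by blast
  define D' E' where "D' = (\<Prod>j<m. [:1, - (q ^ (2 * j + 2)):])"
    and "E' = (\<Prod>i<N. [:q, - (q ^ (4 * i + 5)):])"
  have D': "poly D' b = D b" and E': "poly E' b = E b" for b
    by (simp_all add: D'_def D_def E'_def E_def poly_prod algebra_simps eval_nat_numeral)
  have zero: "poly (P * E' - R * D') c = 0"
    if "quad_sum q a c m = a_value q c N" "\<forall>i. c * q ^ (2 * i + 2) \<noteq> 1" for c
    by (simp add: D' E' that(1) mult_ac flip: P[OF that(2)] R[OF that(2)])
  have "P * E' - R * D' = 0"
  proof (rule ccontr)
    assume "P * E' - R * D' \<noteq> 0"
    then have "finite {x. poly (P * E' - R * D') x = 0}"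
      by (rule poly_roots_finite)
    moreover have "range (\<lambda>j. q ^ (4 * j + 1)) \<subseteq> {x. poly (P * E' - R * D') x = 0}"
    proof safe
      fix j
      have "\<forall>i. q ^ (4 * j + 1) * q ^ (2 * i + 2) \<noteq> 1"
        by (intro allI q_power_mult_neq_1) simp
      with at[of j] show "poly (P * E' - R * D') (q ^ (4 * j + 1)) = 0"
        by (rule zero)
    qed
    moreover have "inj (\<lambda>j. q ^ (4 * j + 1))"
      by (rule injI) (simp add: q_power_eq_iff del: power_Suc)
    ultimately show False
      using finite_subset range_inj_infinite by blast
  qed
  then have "poly P b * E b = poly R b * D b"
    by (metis D' E' eq_iff_diff_eq_0 poly_mult)
  then have "quad_sum q a b m * (D b * E b) = a_value q b N * (D b * E b)"
    using b by (simp add: mult_ac flip: P R)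
  moreover have "2 * (2 * i + 1) + 2 = 4 * i + (4::nat)" for i
    by simp
  then have "b * q ^ (4 * i + 4) \<noteq> 1" for i
    using b by metis
  then have "D b \<noteq> 0" "E b \<noteq> 0"
    using b q_nonzero by (auto simp: D_def E_def simp del: power_Suc)
  ultimately show ?thesis by simp
qed

end

section \<open>Translation of the q-Pochhammer symbols\<close>

lemma q_poch_power: "q_poch x (q ^ c) k = (\<Prod>j<k. 1 - x * q ^ (c * j))"
  by (simp add: q_poch_def power_mult)

lemma summand_eq:
  fixes q a b :: "'a::field"
  assumes "a \<noteq> 0" "b \<noteq> 0"
  shows "(q_pochs [q, a * q, q / a] (q ^ 2) k * q_poch (q / b) (q ^ 4) k)
      / (q_pochs [q ^ 4, q ^ 4 / a, a * q ^ 4] (q ^ 4) k * q_poch (b * q ^ 2) (q ^ 2) k)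
      * q ^ (k ^ 2 + k) * b ^ k
    = weight q k * a_factor q a k * b_factor q b k"
proof -
  have pw: "q * q ^ j = q ^ (j + 1)" "q ^ 2 * q ^ j = q ^ (j + 2)" "q ^ 4 * q ^ j = q ^ (j + 4)" for j
    unfolding power_add by (simp_all only: mult.commute power_one_right)
  have div: "1 - x / a * y = (a - x * y) / a" "1 - x / b * y = (b - x * y) / b" for x y
    using assms by (simp_all add: field_simps)
  have b: "b ^ k = (\<Prod>j<k. b)"
    by simp
  have "(q_pochs [q, a * q, q / a] (q ^ 2) k * q_poch (q / b) (q ^ 4) k)
      / (q_pochs [q ^ 4, q ^ 4 / a, a * q ^ 4] (q ^ 4) k * q_poch (b * q ^ 2) (q ^ 2) k) * b ^ k
    = (\<Prod>j<k. (1 - q ^ (2 * j + 1)) / (1 - q ^ (4 * j + 4))) * a_factor q a k * b_factor q b k"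
    unfolding q_pochs_def q_poch_power a_factor_def b_factor_def b
      list.map prod_list.Cons prod_list.Nil mult_1_right div mult.assoc[of _ "q ^ _"] mult.assoc[of _ q] pw
      prod.distrib[symmetric] prod_dividef[symmetric]
    by (rule prod.cong[OF refl]) (use assms in simp)
  moreover have "x * w * y = w * z" if "x * y = z" for w x y z :: 'a
    using that by auto
  ultimately show ?thesis
    unfolding weight_def mult.assoc[of "q ^ (k ^ 2 + k)"] by (simp only:)
qed

text \<open>The numerator is the denominator shifted by one factor, so only the last factor
  \<open>1 - q ^ (4 * N + 1)\<close> and the first one \<open>1 - q\<close> remain.\<close>

lemma q_poch_telescope:
  fixes q :: "'a::field"
  assumes "\<And>i. i > 0 \<Longrightarrow> q ^ i \<noteq> 1"
  shows "q_poch (q ^ 5) (q ^ 4) N / q_poch q (q ^ 4) N = q_int q (4 * N + 1)"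
proof (induction N)
  case 0
  then show ?case
    using assms[of 1] by (simp add: q_poch_def q_int_def)
next
  case (Suc N)
  have "q ^ 5 * (q ^ 4) ^ N = q ^ (4 * Suc N + 1)" "q * (q ^ 4) ^ N = q ^ (4 * N + 1)"
    by (simp_all add: eval_nat_numeral power_mult[symmetric] mult_ac flip: power_add power_Suc)
  then have "q_poch (q ^ 5) (q ^ 4) (Suc N) / q_poch q (q ^ 4) (Suc N)
    = q_int q (4 * N + 1) * ((1 - q ^ (4 * Suc N + 1)) / (1 - q ^ (4 * N + 1)))"
    unfolding Suc.IH[symmetric] by (simp add: q_poch_def)
  then show ?case
    using assms[of "4 * N + 1"] by (simp add: q_int_def)
qed

lemma a_value_eq:
  fixes q b :: "'a::field"
  assumes "b \<noteq> 0" "\<And>i. i > 0 \<Longrightarrow> q ^ i \<noteq> 1"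
  shows "q_pochs [q ^ 5, q ^ 2 / b] (q ^ 4) N / q_pochs [q, b * q ^ 4] (q ^ 4) N * (b / q) ^ N = a_value q b N"
proof -
  have pw: "q ^ 2 * q ^ j = q ^ (j + 2)" "q ^ 4 * q ^ j = q ^ (j + 4)" for j
    unfolding power_add by (simp_all only: mult.commute)
  have div: "1 - x / b * y = (b - x * y) / b" for x y
    using assms by (simp add: field_simps)
  have b: "(b / q) ^ N = (\<Prod>j<N. b / q)"
    by simp
  have "q_poch (q ^ 2 / b) (q ^ 4) N / q_poch (b * q ^ 4) (q ^ 4) N * (b / q) ^ N
    = (\<Prod>i<N. (b - q ^ (4 * i + 2)) / (q * (1 - b * q ^ (4 * i + 4))))"
    unfolding q_poch_power b div mult.assoc[of _ "q ^ _"] pw prod.distrib[symmetric] prod_dividef[symmetric]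
    by (rule prod.cong[OF refl]) (use assms in simp)
  moreover have "x * y / (u * v) * w = (x / u) * (y / v * w)" for u v w x y :: 'a
    by simp
  moreover have "q_poch (q ^ 5) (q ^ 4) N / q_poch q (q ^ 4) N = q_int q (4 * N + 1)"
    using assms(2) by (rule q_poch_telescope)
  ultimately show ?thesis
    unfolding a_value_def q_pochs_def list.map prod_list.Cons prod_list.Nil mult_1_right by (simp only:)
qed

lemma b_value_eq:
  fixes q a :: "'a::field"
  assumes "a \<noteq> 0"
  shows "q_pochs [q ^ 3, q ^ 5] (q ^ 4) N / q_pochs [a * q ^ 4, q ^ 4 / a] (q ^ 4) N = b_value q a N"
proof -
  have pw: "q ^ 3 * q ^ j = q ^ (j + 3)" "q ^ 4 * q ^ j = q ^ (j + 4)" "q ^ 5 * q ^ j = q ^ (j + 5)" for j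
    unfolding power_add by (simp_all only: mult.commute)
  have div: "1 - x / a * y = (a - x * y) / a" for x y
    using assms by (simp add: field_simps)
  show ?thesis
    unfolding q_pochs_def q_poch_power b_value_def list.map prod_list.Cons prod_list.Nil mult_1_right
      div mult.assoc[of _ "q ^ _"] pw prod.distrib[symmetric] prod_dividef[symmetric]
    by (rule prod.cong[OF refl]) (use assms in \<open>simp add: mult_ac\<close>)
qed

subsection \<open>Gaussian binomial coefficients and congruence rules for the sum\<close>

context
  fixes p :: "'a::{idom, semiring_gcd}" and q :: "'a fract"
  assumes q: "denom_coprime p q"
begin

lemma a_factor_cong:
  assumes "fract_cong a a' p"
    and "\<And>j. coprime_fr p (1 - a * q ^ (4 * j + 4))" "\<And>j. coprime_fr p (a - q ^ (4 * j + 4))"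
    and "\<And>j. a' * q ^ (4 * j + 4) \<noteq> 1" "\<And>j. a' \<noteq> q ^ (4 * j + 4)"
  shows "fract_cong (a_factor q a k) (a_factor q a' k) p"
  unfolding a_factor_def
proof (intro fract_cong_prod fract_cong_divide fract_cong_mult fract_cong_diff fract_cong_refl coprime_fr_mult)
  show "(1 - a' * q ^ (4 * j + 4)) * (a' - q ^ (4 * j + 4)) \<noteq> 0" for j
    using assms(4,5)[of j] by auto
qed (use assms q in auto)

lemma b_factor_cong:
  assumes "fract_cong b b' p"
    and "\<And>j. coprime_fr p (1 - b * q ^ (2 * j + 2))" "\<And>j. b' * q ^ (2 * j + 2) \<noteq> 1"
  shows "fract_cong (b_factor q b k) (b_factor q b' k) p"
  unfolding b_factor_def
proof (intro fract_cong_prod fract_cong_divide fract_cong_mult fract_cong_diff fract_cong_refl)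
  show "1 - b' * q ^ (2 * j + 2) \<noteq> 0" for j
    using assms(3)[of j] by auto
qed (use assms q in auto)

text \<open>Integrality of \<open>weight\<close> is a hypothesis because it cannot be checked factor
  by factor. The new values \<open>a'\<close>, \<open>b'\<close> only have to avoid zeros of
  denominators, as in \<open>fract_cong_divide\<close>.\<close>

lemma quad_sum_cong:
  assumes "\<And>k. denom_coprime p (weight q k)" "\<And>k. denom_coprime p (q_int q k)"
    and "fract_cong a a' p" "fract_cong b b' p"
    and "\<And>j. coprime_fr p (1 - a * q ^ (4 * j + 4))" "\<And>j. coprime_fr p (a - q ^ (4 * j + 4))"
    and "\<And>j. a' * q ^ (4 * j + 4) \<noteq> 1" "\<And>j. a' \<noteq> q ^ (4 * j + 4)"
    and "\<And>j. coprime_fr p (1 - b * q ^ (2 * j + 2))" "\<And>j. b' * q ^ (2 * j + 2) \<noteq> 1"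
  shows "fract_cong (quad_sum q a b m) (quad_sum q a' b' m) p"
  unfolding quad_sum_def
  by (intro fract_cong_sum fract_cong_mult a_factor_cong b_factor_cong fract_cong_refl) (use assms in auto)

lemma a_value_cong:
  assumes "denom_coprime p (q_int q (4 * N + 1))" "coprime_fr p q" "fract_cong b b' p"
    and "\<And>j. coprime_fr p (1 - b * q ^ (4 * j + 4))" "\<And>j. b' * q ^ (4 * j + 4) \<noteq> 1"
  shows "fract_cong (a_value q b N) (a_value q b' N) p"
  unfolding a_value_def
proof (intro fract_cong_prod fract_cong_divide fract_cong_mult fract_cong_diff fract_cong_refl coprime_fr_mult)
  show "q * (1 - b' * q ^ (4 * j + 4)) \<noteq> 0" for j
    using assms(2) assms(5)[of j] by (auto dest: coprime_fr_imp_nonzero)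
qed (use assms q in auto)

lemma b_value_cong:
  assumes "fract_cong a a' p"
    and "\<And>j. coprime_fr p (1 - a * q ^ (4 * j + 4))" "\<And>j. coprime_fr p (a - q ^ (4 * j + 4))"
    and "\<And>j. a' * q ^ (4 * j + 4) \<noteq> 1" "\<And>j. a' \<noteq> q ^ (4 * j + 4)"
  shows "fract_cong (b_value q a N) (b_value q a' N) p"
  unfolding b_value_def
proof (intro fract_cong_prod fract_cong_divide fract_cong_mult fract_cong_diff fract_cong_refl coprime_fr_mult)
  show "(1 - a' * q ^ (4 * j + 4)) * (a' - q ^ (4 * j + 4)) \<noteq> 0" for j
    using assms(4,5)[of j] by auto
qed (use assms q in auto)

end

text \<open>The quotient is a Gaussian binomial coefficient. Its Pascal rule is
  \<open>1 - x ^ (k + l) = (1 - x ^ k) + x ^ k * (1 - x ^ l)\<close>: multiplied by the product of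
  length \<open>k + l - 1\<close>, both summands are divisible by induction.\<close>

lemma q_factorial_mult_dvd:
  fixes x :: "'a::{idom, algebraic_semidom}"
  shows "(\<Prod>i<k. 1 - x ^ Suc i) * (\<Prod>i<l. 1 - x ^ Suc i) dvd (\<Prod>i<k + l. 1 - x ^ Suc i)"
proof (induction "k + l" arbitrary: k l rule: less_induct)
  case less
  let ?f = "\<lambda>n. \<Prod>i<n. 1 - x ^ Suc i"
  show ?case
  proof (cases k; cases l)
    fix k' l' assume kl: "k = Suc k'" "l = Suc l'"
    have "?f k' * ?f l dvd ?f (k' + l)" "?f k * ?f l' dvd ?f (k' + l)"
      using less[of k' l] less[of k l'] kl by (simp_all del: prod.lessThan_Suc)
    then have "(?f k' * ?f l) * (1 - x ^ k) dvd ?f (k' + l) * (1 - x ^ k)"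
      "(?f k * ?f l') * (1 - x ^ l) dvd ?f (k' + l) * (1 - x ^ l)"
      by (auto intro: mult_dvd_mono)
    then have "?f k * ?f l dvd ?f (k' + l) * (1 - x ^ k)" "?f k * ?f l dvd ?f (k' + l) * (1 - x ^ l)"
      by (simp_all add: kl mult_ac)
    then have "?f k * ?f l dvd ?f (k' + l) * (1 - x ^ k) + x ^ k * (?f (k' + l) * (1 - x ^ l))"
      by (rule dvd_add[OF _ dvd_mult])
    also have "\<dots> = ?f (k' + l) * (1 - x ^ (k + l))"
      by (simp add: algebra_simps power_add)
    also have "\<dots> = ?f (k + l)"
      by (simp add: kl)
    finally show ?thesis .
  qed simp_all
qed

text \<open>Odd and even exponents are separated, and
  \<open>1 - x ^ (2 * i) = (1 - x ^ i) * (1 + x ^ i)\<close>. This trades the odd product in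
  \<open>weight\<close> for q-factorials.\<close>

lemma odd_q_factorial:
  fixes x :: "'a::{idom, algebraic_semidom}"
  shows "(\<Prod>i<2 * k. 1 - x ^ Suc i)
    = (\<Prod>j<k. 1 - x ^ (2 * j + 1)) * ((\<Prod>j<k. 1 - x ^ Suc j) * (\<Prod>j<k. 1 + x ^ Suc j))"
proof (induction k)
  case (Suc k)
  have "2 * Suc k = Suc (Suc (2 * k))"
    by simp
  then have "(\<Prod>i<2 * Suc k. 1 - x ^ Suc i)
    = (\<Prod>i<2 * k. 1 - x ^ Suc i) * (1 - x ^ Suc (2 * k)) * (1 - x ^ Suc (Suc (2 * k)))"
    by simp
  also have "1 - x ^ Suc (Suc (2 * k)) = (1 - x ^ Suc k) * (1 + x ^ Suc k)"
    by (simp add: algebra_simps mult_2 mult_2_right flip: power_add)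
  finally show ?case
    unfolding Suc.IH by (simp add: mult_ac)
qed simp

subsection \<open>Coprimality in the polynomial ring\<close>

text \<open>In degree 1 one of two factors is constant, and it divides every coefficient, in
  particular the unit.\<close>

lemma irreducible_linear:
  fixes p :: "'a::idom poly"
  assumes "degree p = 1" "coeff p i dvd 1"
  shows "irreducible p"
proof (rule irreducibleI)
  show "p \<noteq> 0" using assms(1) by auto
  show "\<not> p dvd 1"
    using assms(1) by (metis is_unit_iff_degree degree_0 dvd_0_left_iff is_unit_polyE degree_pCons_0 zero_neq_one)
next
  have *: "u dvd 1" if "p = u * v" "degree u = 0" for u v :: "'a poly"
  proof -
    from that(2) obtain c where "u = [:c:]" by (auto elim: degree_eq_zeroE)
    moreover from this have "c dvd coeff p i"
      using that(1) by simp
    ultimately show ?thesis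
      using assms(2) by (meson dvd_trans is_unit_const_poly_iff)
  qed
  fix u v assume uv: "p = u * v"
  with assms(1) have "degree u + degree v = 1"
    by (metis degree_mult_eq degree_0 mult_eq_0_iff zero_neq_one)
  then have "degree u = 0 \<or> degree v = 0" by auto
  then show "u dvd 1 \<or> v dvd 1"
    using *[of u v] *[of v u] uv by (auto simp: mult.commute)
qed

lemma dvd_const_polyD:
  fixes c :: "'a::idom poly"
  assumes "c dvd [:m:]" "m \<noteq> 0"
  obtains g where "c = [:g:]" "g dvd m"
proof -
  from assms(1) obtain e where e: "[:m:] = c * e" ..
  with assms(2) have "degree c + degree e = 0"
    by (metis degree_mult_eq degree_pCons_0 mult_eq_0_iff pCons_eq_0_iff)
  then obtain g h where "c = [:g:]" "e = [:h:]"
    by (auto elim!: degree_eq_zeroE)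
  with e that show thesis by auto
qed

text \<open>A divisor of the nonzero constant involves neither \<open>a\<close> nor
  \<open>b\<close>, so it survives the specialisation \<open>b = B\<close>, \<open>a = A\<close>.
  One well-chosen specialisation thus proves coprimality without factoring \<open>m\<close>.\<close>

lemma coprime_const_poly:
  fixes d :: pol
  assumes "coprime (poly (poly d B) A) m" "m \<noteq> 0"
  shows "coprime d [:[:m:]:]"
proof (rule coprimeI)
  fix c assume c: "c dvd d" "c dvd [:[:m:]:]"
  from c(2) assms(2) obtain g' where g': "c = [:g':]" "g' dvd [:m:]"
    by (elim dvd_const_polyD) auto
  with assms(2) obtain g where g: "g' = [:g:]" "g dvd m"
    by (elim dvd_const_polyD) auto
  from c(1) obtain e where "d = c * e" ..
  then have "g dvd poly (poly d B) A"
    by (simp add: g' g)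
  with g(2) assms(1) have "g dvd 1"
    by (metis coprime_common_divisor)
  then show "c dvd 1"
    by (simp only: g' g is_unit_const_poly_iff)
qed

definition eval_pol :: "rat \<Rightarrow> rat \<Rightarrow> rat \<Rightarrow> pol \<Rightarrow> rat" where
  "eval_pol x y z p = poly (poly (poly p [:[:z:]:]) [:y:]) x"

lemma eval_pol_simps [simp]:
  "eval_pol x y z (p + r) = eval_pol x y z p + eval_pol x y z r"
  "eval_pol x y z (p - r) = eval_pol x y z p - eval_pol x y z r"
  "eval_pol x y z (p * r) = eval_pol x y z p * eval_pol x y z r"
  "eval_pol x y z (p ^ n) = eval_pol x y z p ^ n"
  "eval_pol x y z 1 = 1" "eval_pol x y z 0 = 0"
  "eval_pol x y z q_pol = x" "eval_pol x y z a_pol = y" "eval_pol x y z b_pol = z"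
  by (simp_all add: eval_pol_def q_pol_def a_pol_def b_pol_def poly_power)

text \<open>A rational zero of \<open>p\<close> at which \<open>d\<close> does not vanish shows that
  \<open>p\<close> does not divide \<open>d\<close>; irreducible elements are prime here.\<close>

lemma coprime_irreducibleI:
  assumes "irreducible p" "eval_pol x y z p = 0" "eval_pol x y z d \<noteq> 0"
  shows "coprime d p"
proof -
  have "\<not> p dvd d"
  proof
    assume "p dvd d"
    then obtain e where "d = p * e" ..
    with assms show False by simp
  qed
  moreover have "prime_elem p"
    using assms(1) by (rule irreducible_imp_prime_poly)
  ultimately have "coprime p d"
    by (intro prime_elem_imp_coprime)
  then show ?thesis
    by (rule coprime_commute[THEN iffD1])
qed

lemma q_pol_power: "q_pol ^ n = [:[:[:0, 1:] ^ n:]:]"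
  by (simp add: q_pol_def poly_const_pow)

lemma irreducible_factors:
  "irreducible (1 - a_pol * q_pol ^ n)" "irreducible (a_pol - q_pol ^ n)" "irreducible (b_pol - q_pol ^ n)"
proof -
  have "irreducible [:1, - ([:0, 1:] ^ n) :: rat poly:]"
    by (rule irreducible_linear[of _ 0]) simp_all
  then show "irreducible (1 - a_pol * q_pol ^ n)"
    unfolding q_pol_power a_pol_def by (simp add: one_pCons irreducible_const_poly_iff)
  have "irreducible [:- ([:0, 1:] ^ n) :: rat poly, 1:]"
    by (rule irreducible_linear[of _ 1]) simp_all
  then show "irreducible (a_pol - q_pol ^ n)"
    unfolding q_pol_power a_pol_def by (simp add: irreducible_const_poly_iff)
  show "irreducible (b_pol - q_pol ^ n)"
    unfolding q_pol_power b_pol_def by (rule irreducible_linear[of _ 1]) simp_all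
qed

text \<open>Modulo a common divisor \<open>x ^ i = -1\<close> and \<open>x ^ n = 1\<close>, so
  \<open>x ^ (i * n)\<close> is both \<open>-1\<close>, as \<open>n\<close> is odd, and 1. The
  divisor then divides 2, a unit over the rationals.\<close>

lemma coprime_one_plus_power:
  fixes x :: "rat poly"
  assumes "odd n"
  shows "coprime (1 + x ^ i) (1 - x ^ n)"
proof (rule coprimeI)
  fix c assume c: "c dvd 1 + x ^ i" "c dvd 1 - x ^ n"
  have "(x ^ i - (- 1)) dvd (x ^ i) ^ n - (- 1) ^ n"
    by (metis dvd_triv_left power_diff_sumr2)
  then have "1 + x ^ i dvd 1 + (x ^ i) ^ n"
    using assms by (simp add: add.commute)
  moreover have "x ^ n - 1 dvd (x ^ n) ^ i - 1 ^ i"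
    by (metis dvd_triv_left power_diff_sumr2)
  then have "1 - x ^ n dvd 1 - (x ^ i) ^ n"
    by (metis (no_types) minus_diff_eq dvd_minus_iff minus_dvd_iff power_one power_mult mult.commute)
  ultimately have "c dvd (1 + (x ^ i) ^ n) + (1 - (x ^ i) ^ n)"
    using c by (blast intro: dvd_add dvd_trans)
  then have "c dvd [:2:]"
    by (simp add: numeral_poly[symmetric])
  moreover have "[:2:] dvd (1 :: rat poly)"
    by (simp add: is_unit_const_poly_iff dvd_field_iff)
  ultimately show "c dvd 1"
    by (rule dvd_trans)
qed

lemma coprime_one_minus_power:
  fixes x :: "rat poly"
  assumes "n > 0"
  shows "coprime x (1 - x ^ n)"
proof (rule coprimeI)
  fix c assume c: "c dvd x" "c dvd 1 - x ^ n"
  then have "c dvd x ^ n"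
    using assms by (meson dvd_power dvd_trans)
  then have "c dvd (1 - x ^ n) + x ^ n"
    by (rule dvd_add[OF c(2)])
  then show "c dvd 1" by (simp only: diff_add_cancel)
qed

text \<open>\<open>1 - q_pol ^ n\<close> stands in for its divisor \<open>[n]\<close>: coprimality
  to this multiple is easier to test and passes to all divisors, the actual modulus among
  them.\<close>

definition modulus :: "nat \<Rightarrow> pol" where
  "modulus n = (1 - q_pol ^ n) * (1 - a_pol * q_pol ^ n) * (a_pol - q_pol ^ n) * (b_pol - q_pol ^ n)"

lemma modulus_nonunit: "\<not> modulus n dvd 1"
proof
  assume "modulus n dvd 1"
  then obtain e where "1 = modulus n * e" ..
  then have "eval_pol 2 0 (2 ^ n) 1 = eval_pol 2 0 (2 ^ n) (modulus n) * eval_pol 2 0 (2 ^ n) e"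
    by (metis eval_pol_simps(3))
  then show False
    by (simp add: modulus_def)
qed

text \<open>The three points have \<open>q = 2\<close> and are zeros of the three linear factors.
  The free variable is set to \<open>-1\<close>, which keeps \<open>a - b\<close>,
  \<open>1 - a b\<close> and the factors \<open>1 - b q ^ k\<close> nonzero there.\<close>

lemma coprime_modulusI:
  assumes "n > 0" "coprime (poly (poly d B) A) (1 - [:0, 1:] ^ n)"
    and "eval_pol 2 (1 / 2 ^ n) (- 1) d \<noteq> 0" "eval_pol 2 (2 ^ n) (- 1) d \<noteq> 0"
    and "eval_pol 2 (- 1) (2 ^ n) d \<noteq> 0"
  shows "coprime d (modulus n)"
proof -
  have "1 < (2 :: rat) ^ n"
    by (rule one_less_power) (use assms(1) in auto)
  then have "(2 :: rat) ^ n \<noteq> 1"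
    by linarith
  then have "poly ([:0, 1:] ^ n) 2 \<noteq> (poly 1 2 :: rat)"
    by (simp add: poly_power)
  then have "1 - [:0, 1:] ^ n \<noteq> (0 :: rat poly)"
    by (metis eq_iff_diff_eq_0)
  with assms(2) have "coprime d [:[:1 - [:0, 1:] ^ n:]:]"
    by (rule coprime_const_poly)
  also have "[:[:1 - [:0, 1:] ^ n:]:] = 1 - q_pol ^ n"
    by (simp add: q_pol_power one_pCons)
  finally have "coprime d (1 - q_pol ^ n)" .
  moreover have "coprime d (1 - a_pol * q_pol ^ n)"
    by (rule coprime_irreducibleI[OF irreducible_factors(1) _ assms(3)]) simp
  moreover have "coprime d (a_pol - q_pol ^ n)"
    by (rule coprime_irreducibleI[OF irreducible_factors(2) _ assms(4)]) simp
  moreover have "coprime d (b_pol - q_pol ^ n)"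
    by (rule coprime_irreducibleI[OF irreducible_factors(3) _ assms(5)]) simp
  ultimately show ?thesis
    by (simp add: modulus_def)
qed

lemma poly_poly_pol [simp]:
  "poly (poly q_pol B) A = [:0, 1:]" "poly (poly a_pol B) A = A" "poly (poly b_pol B) A = poly B A"
  by (simp_all add: q_pol_def a_pol_def b_pol_def)

text \<open>Except for \<open>q_pol\<close> and \<open>1 + q_pol ^ k\<close>, the chosen
  specialisation turns each polynomial into 1, for instance \<open>a - q ^ k\<close> at
  \<open>a = 1 + q ^ k\<close>.\<close>

lemma coprime_modulus:
  assumes "n > 0"
  shows "coprime q_pol (modulus n)" "coprime a_pol (modulus n)"
    "k \<noteq> n \<Longrightarrow> coprime (1 - a_pol * q_pol ^ k) (modulus n)"
    "k \<noteq> n \<Longrightarrow> coprime (a_pol - q_pol ^ k) (modulus n)"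
    "coprime (1 - b_pol * q_pol ^ k) (modulus n)"
    "coprime (a_pol - b_pol) (modulus n)" "coprime (1 - a_pol * b_pol) (modulus n)"
    "odd n \<Longrightarrow> coprime (1 + q_pol ^ k) (modulus n)"
proof -
  let ?x = "[:0, 1:] :: rat poly"
  define u v where "u = (2 :: rat) ^ k" and "v = (2 :: rat) ^ n"
  have v: "v > 1"
    using assms one_less_power[of "2 :: rat" n] by (simp add: v_def)
  have u: "u > 0"
    by (simp add: u_def)
  have "v * u = 2 ^ (n + k)"
    by (simp add: u_def v_def power_add)
  then have uv: "v * u > 1"
    using assms one_less_power[of "2 :: rat" "n + k"] by simp
  have ne: "u \<noteq> v" if "k \<noteq> n"
    using that by (simp add: u_def v_def)
  show "coprime q_pol (modulus n)"
    by (rule coprime_modulusI[of _ _ 0 0]) (use assms coprime_one_minus_power in simp_all)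
  show "coprime a_pol (modulus n)"
    by (rule coprime_modulusI[of _ _ 0 1]) (use assms in simp_all)
  show "coprime (1 - a_pol * q_pol ^ k) (modulus n)" if "k \<noteq> n"
    by (rule coprime_modulusI[of _ _ 0 0], unfold eval_pol_simps u_def[symmetric] v_def[symmetric])
      (use assms ne[OF that] u v uv in auto)
  show "coprime (a_pol - q_pol ^ k) (modulus n)" if "k \<noteq> n"
    by (rule coprime_modulusI[of _ _ 0 "1 + ?x ^ k"], unfold eval_pol_simps u_def[symmetric] v_def[symmetric])
      (use assms ne[OF that] u v uv in \<open>auto simp: poly_power divide_eq_eq mult.commute\<close>)
  show "coprime (1 - b_pol * q_pol ^ k) (modulus n)"
    by (rule coprime_modulusI[of _ _ 0 0], unfold eval_pol_simps u_def[symmetric] v_def[symmetric])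
      (use assms u v uv in auto)
  show "coprime (a_pol - b_pol) (modulus n)"
    by (rule coprime_modulusI[of _ _ 0 1], unfold eval_pol_simps u_def[symmetric] v_def[symmetric])
      (use assms u v uv in \<open>auto simp: add_eq_0_iff divide_eq_eq\<close>)
  show "coprime (1 - a_pol * b_pol) (modulus n)"
    by (rule coprime_modulusI[of _ _ 0 0], unfold eval_pol_simps u_def[symmetric] v_def[symmetric])
      (use assms u v uv in \<open>auto simp: add_eq_0_iff divide_eq_eq\<close>)
  show "coprime (1 + q_pol ^ k) (modulus n)" if "odd n"
    by (rule coprime_modulusI[of _ _ 0 0], unfold eval_pol_simps u_def[symmetric] v_def[symmetric])
      (use assms u v uv that in \<open>auto simp: poly_power coprime_one_plus_power\<close>)
qed

lemma denom_coprime_q_power: "denom_coprime p (to_fr q_pol ^ k)"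
  by (simp only: denom_coprime_to_fr flip: to_fr_power)

lemma coprime_fr_modulusI: "coprime d (modulus n) \<Longrightarrow> coprime_fr (modulus n) (to_fr d)"
  unfolding coprime_fr_def using modulus_nonunit[of n] by (intro exI[of _ d]) auto

lemma coprime_fr_dvd:
  assumes "coprime_fr p x" "p' dvd p"
  shows "coprime_fr p' x"
  using assms unfolding coprime_fr_def by (blast intro: coprime_divisors dvd_refl)

lemma coprime_fr_modulus:
  assumes "n > 0"
  shows "coprime_fr (modulus n) (to_fr q_pol)" "coprime_fr (modulus n) (to_fr a_pol)"
    "k \<noteq> n \<Longrightarrow> coprime_fr (modulus n) (1 - to_fr a_pol * to_fr q_pol ^ k)"
    "k \<noteq> n \<Longrightarrow> coprime_fr (modulus n) (to_fr a_pol - to_fr q_pol ^ k)"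
    "coprime_fr (modulus n) (1 - to_fr b_pol * to_fr q_pol ^ k)"
    "coprime_fr (modulus n) (to_fr a_pol - to_fr b_pol)"
    "coprime_fr (modulus n) (1 - to_fr a_pol * to_fr b_pol)"
    "odd n \<Longrightarrow> coprime_fr (modulus n) (1 + to_fr q_pol ^ k)"
  using coprime_modulus[OF assms, THEN coprime_fr_modulusI] unfolding to_fr_simps by auto

section \<open>The element \<open>q\<close> of the fraction field and the denominators of the
  weights\<close>

lemma q_pol_neq_1: "q_pol \<noteq> 1"
  using eval_pol_simps(5,7)[of 0 0 0] by (metis zero_neq_one)

lemma to_fr_q_int: "q_int (to_fr q_pol) k = to_fr (q_int q_pol k)"
proof -
  have "to_fr q_pol \<noteq> 1"
    using q_pol_neq_1 by (metis to_fr_1 to_fr_eq_iff)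
  then show ?thesis
    using arg_cong[OF q_int_mult[OF q_pol_neq_1], of to_fr k] q_int_mult[of "to_fr q_pol" k]
    by (simp add: to_fr_simps) (metis eq_iff_diff_eq_0 mult_left_cancel)
qed

lemma to_fr_q_power_neq_1:
  assumes "i > 0"
  shows "to_fr q_pol ^ i \<noteq> 1"
proof
  assume "to_fr q_pol ^ i = 1"
  then have "q_pol ^ i = 1"
    by (metis to_fr_1 to_fr_eq_iff to_fr_power)
  then have "eval_pol 2 0 0 (q_pol ^ i) = eval_pol 2 0 0 1"
    by simp
  moreover have "1 < (2 :: rat) ^ i"
    by (rule one_less_power) (use assms in auto)
  ultimately show False by simp
qed

lemma q_int_dvd: "q_int q_pol n dvd 1 - q_pol ^ n"
  by (metis q_int_mult[OF q_pol_neq_1] dvd_triv_right)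

lemma q_int_dvd_modulus: "q_int q_pol n dvd modulus n"
  using q_int_dvd[of n] by (simp add: modulus_def mult.assoc)

text \<open>Both the numerator and the denominator of the weight may share factors with \<open>1 - q ^ n\<close>; for \<open>s = 1\<close>,
  cancellation leaves the Gaussian binomial coefficient \<open>2 k\<close> over \<open>k\<close>, divided by factors \<open>1 + q ^ i\<close>,
  which are coprime to \<open>1 - q ^ n\<close> for odd \<open>n\<close>.\<close>

lemma weight_eq:
  assumes "s * (\<Prod>i<2 * k. 1 - q_pol ^ Suc i) = X * (\<Prod>i<k. 1 - q_pol ^ Suc i) ^ 2"
  shows "to_fr s * weight (to_fr q_pol) k
    = to_fr X * (to_fr q_pol ^ (k ^ 2 + k)
        / (\<Prod>i<k. (1 + to_fr q_pol ^ Suc i) ^ 2 * (1 + to_fr q_pol ^ (2 * Suc i))))"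
proof -
  define q where "q = to_fr q_pol"
  define F G H J where "F = (\<Prod>i<k. 1 - q ^ Suc i)" and "G = (\<Prod>i<k. 1 + q ^ Suc i)"
    and "H = (\<Prod>i<k. 1 + q ^ (2 * Suc i))" and "J = (\<Prod>j<k. 1 - q ^ (2 * j + 1))"
  have "F \<noteq> 0"
    using to_fr_q_power_neq_1[of "Suc i" for i] by (auto simp: F_def q_def simp del: power_Suc)
  have "coprime_fr (modulus 1) (1 + q ^ i)" for i
    unfolding q_def by (rule coprime_fr_modulus) auto
  then have pos: "1 + q ^ i \<noteq> 0" for i
    by (rule coprime_fr_imp_nonzero)
  have "G \<noteq> 0" "H \<noteq> 0"
    unfolding G_def H_def using pos by (simp_all del: power_Suc)
  have "to_fr s * (J * (F * G)) = to_fr X * F ^ 2"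
    using arg_cong[OF assms, of to_fr] unfolding odd_q_factorial
    by (simp only: to_fr_simps to_fr_prod q_def F_def G_def J_def)
  then have main: "to_fr s * J * G = to_fr X * F"
    using \<open>F \<noteq> 0\<close> by (simp add: power2_eq_square)
  have "1 - q ^ (4 * j + 4) = (1 - q ^ Suc j) * (1 + q ^ Suc j) * (1 + q ^ (2 * Suc j))" for j
  proof -
    have "q ^ (4 * j + 4) = (q ^ Suc j) ^ 4" "q ^ (2 * Suc j) = (q ^ Suc j) ^ 2"
      unfolding power_mult[symmetric] by (rule arg_cong[of _ _ "power q"], simp)+
    moreover have "1 - y ^ 4 = (1 - y) * (1 + y) * (1 + y ^ 2)" for y :: "pol fract"
      by algebra
    ultimately show ?thesis by (simp only:)
  qed
  then have "(\<Prod>j<k. 1 - q ^ (4 * j + 4)) = F * G * H"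
    unfolding F_def G_def H_def prod.distrib[symmetric] by simp
  then have "to_fr s * weight q k = q ^ (k ^ 2 + k) * (to_fr s * J / (F * G * H))"
    unfolding weight_def prod_dividef J_def by simp
  also have "to_fr s * J / (F * G * H) = to_fr X / (G ^ 2 * H)"
    using main \<open>F \<noteq> 0\<close> \<open>G \<noteq> 0\<close> \<open>H \<noteq> 0\<close> by (simp add: field_simps power2_eq_square)
  also have "G ^ 2 * H = (\<Prod>i<k. (1 + q ^ Suc i) ^ 2 * (1 + q ^ (2 * Suc i)))"
    unfolding G_def H_def prod.distrib prod_power_distrib ..
  finally show ?thesis
    by (simp add: q_def)
qed

lemma denom_coprime_weight_quotient:
  assumes "odd n"
  shows "denom_coprime (modulus n) (to_fr q_pol ^ (k ^ 2 + k)
        / (\<Prod>i<k. (1 + to_fr q_pol ^ Suc i) ^ 2 * (1 + to_fr q_pol ^ (2 * Suc i))))"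
  by (intro denom_coprime_divide coprime_fr_prod coprime_fr_mult coprime_fr_power coprime_fr_modulus
    denom_coprime_q_power) (use assms odd_pos in auto)

lemma denom_coprime_weight:
  assumes "odd n"
  shows "denom_coprime (modulus n) (weight (to_fr q_pol) k)"
proof -
  have "(\<Prod>i<k. 1 - q_pol ^ Suc i) ^ 2 dvd (\<Prod>i<2 * k. 1 - q_pol ^ Suc i)"
    unfolding power2_eq_square mult_2 by (rule q_factorial_mult_dvd)
  then obtain X where "(\<Prod>i<2 * k. 1 - q_pol ^ Suc i) = (\<Prod>i<k. 1 - q_pol ^ Suc i) ^ 2 * X" ..
  then have "1 * (\<Prod>i<2 * k. 1 - q_pol ^ Suc i) = X * (\<Prod>i<k. 1 - q_pol ^ Suc i) ^ 2"
    by (simp only: mult_1 mult.commute)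
  from weight_eq[OF this] show ?thesis
    using denom_coprime_mult[OF denom_coprime_to_fr denom_coprime_weight_quotient[OF assms, of k]]
    by (simp only: to_fr_1 mult_1)
qed

text \<open>With \<open>F\<close> the q-factorial, \<open>[n]\<close> comes from
  \<open>2 * M + 1 = n\<close> in the first case. In the second,
  \<open>(1 - q ^ (2 * M + 1)) * F (2 * M) = F (n + M)\<close> is divisible by
  \<open>F n * F M = (1 - q ^ n) * F M ^ 2\<close>. Division by \<open>1 - q\<close> then leaves
  \<open>[n]\<close>.\<close>

lemma last_weight_cong_0:
  assumes "odd n" and M: "M = (n - 1) div 2 \<or> M = n - 1"
  shows "fract_cong ((1 - to_fr q_pol ^ (2 * M + 1)) / (1 - to_fr q_pol) * weight (to_fr q_pol) M) 0
    (q_int q_pol n)"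
proof -
  let ?F = "\<lambda>k. \<Prod>i<k. 1 - q_pol ^ Suc i"
  have "n > 0" using assms(1) by (rule odd_pos)
  have "(1 - q_pol ^ n) * ?F M ^ 2 dvd (1 - q_pol ^ (2 * M + 1)) * ?F (2 * M)"
    using M
  proof
    assume "M = (n - 1) div 2"
    with \<open>odd n\<close> have "2 * M + 1 = n" by auto
    moreover have "?F M ^ 2 dvd ?F (2 * M)"
      unfolding power2_eq_square mult_2 by (rule q_factorial_mult_dvd)
    ultimately show ?thesis
      by (simp only: mult_dvd_mono dvd_refl)
  next
    assume "M = n - 1"
    with \<open>n > 0\<close> have n: "n = Suc M" by simp
    have "?F (Suc M) * ?F M dvd ?F (Suc M + M)"
      by (rule q_factorial_mult_dvd)
    also have "?F (Suc M + M) = (1 - q_pol ^ (2 * M + 1)) * ?F (2 * M)"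
      by (simp add: mult_2 mult_2_right mult.commute)
    finally show ?thesis
      unfolding n by (simp add: power2_eq_square mult_ac)
  qed
  then obtain X where "(1 - q_pol ^ (2 * M + 1)) * ?F (2 * M) = (1 - q_pol ^ n) * ?F M ^ 2 * X" ..
  then have "(1 - q_pol ^ (2 * M + 1)) * ?F (2 * M) = ((1 - q_pol ^ n) * X) * ?F M ^ 2"
    by (simp only: mult_ac)
  note eq = weight_eq[OF this, unfolded to_fr_simps]
  have "to_fr (q_int q_pol n) = (1 - to_fr q_pol ^ n) / (1 - to_fr q_pol)"
    unfolding to_fr_q_int[symmetric] by (rule q_int_def)
  moreover have "x / d * w = y / d * (z * r)" if "x * w = y * z * r" for d x y z r w :: "pol fract"
    using that by simp
  ultimately have "(1 - to_fr q_pol ^ (2 * M + 1)) / (1 - to_fr q_pol) * weight (to_fr q_pol) M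
    = to_fr (q_int q_pol n) * (to_fr X * (to_fr q_pol ^ (M ^ 2 + M)
        / (\<Prod>i<M. (1 + to_fr q_pol ^ Suc i) ^ 2 * (1 + to_fr q_pol ^ (2 * Suc i)))))"
    using eq by (simp add: mult_ac)
  moreover have "fract_cong \<dots> 0 (q_int q_pol n)"
    by (intro fract_cong_0I dvd_refl denom_coprime_mult denom_coprime_to_fr
      denom_coprime_dvd[OF denom_coprime_weight_quotient[OF assms(1)] q_int_dvd_modulus])
  ultimately show ?thesis by simp
qed

subsection \<open>The congruences for the individual factors of the modulus\<close>

context
  fixes n :: nat and q a b :: "pol fract"
  defines "q \<equiv> to_fr q_pol" and "a \<equiv> to_fr a_pol" and "b \<equiv> to_fr b_pol"
begin

lemma denom_coprime_gens: "denom_coprime p q" "denom_coprime p a" "denom_coprime p b"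
  "denom_coprime p (q_int q k)"
  unfolding q_def a_def b_def to_fr_q_int by blast+

lemma q_neq_0: "q \<noteq> 0" and q_power_neq_1: "i > 0 \<Longrightarrow> q ^ i \<noteq> 1"
  using to_fr_q_power_neq_1[of i] coprime_fr_modulus(1)[of 1, THEN coprime_fr_imp_nonzero]
  by (simp_all add: q_def)

lemma coprime_fr_gens:
  assumes "n > 0" "p dvd modulus n"
  shows "coprime_fr p q" "coprime_fr p a"
    "k \<noteq> n \<Longrightarrow> coprime_fr p (1 - a * q ^ k)"
    "k \<noteq> n \<Longrightarrow> coprime_fr p (a - q ^ k)"
    "coprime_fr p (1 - b * q ^ k)" "coprime_fr p (a - b)" "coprime_fr p (1 - a * b)"
  using coprime_fr_modulus[OF assms(1), THEN coprime_fr_dvd[OF _ assms(2)]]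
  unfolding q_def a_def b_def by auto

lemma coprime_fr_b_shift:
  assumes "n > 0" "p dvd modulus n"
  shows "coprime_fr p (1 - b * q ^ i * q ^ j)"
  using coprime_fr_gens(5)[OF assms, of "i + j"] by (simp add: power_add mult.assoc)

text \<open>At \<open>a = 0\<close>, \<open>b = 1\<close> the second product vanishes and the first
  becomes a power of \<open>q\<close> up to sign, which is coprime to
  \<open>1 - q ^ n\<close>.\<close>

lemma coprime_bracket:
  assumes "n > 0"
  defines "c \<equiv> \<lambda>i. b_pol * q_pol ^ (4 * i)"
  shows "coprime ((\<Prod>i<n. (1 - a_pol * c i * q_pol ^ 3) * (a_pol - c i * q_pol ^ 3))
    - (\<Prod>i<n. a_pol * (1 - c i * q_pol ^ 2) * (1 - c i * q_pol ^ 4))) (1 - q_pol ^ n)"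
proof -
  have "coprime (\<Prod>i<n. - ([:0, 1:] ^ (4 * i) * [:0, 1:] ^ 3)) (1 - [:0, 1:] ^ n :: rat poly)"
    using coprime_one_minus_power[OF assms(1), of "[:0, 1:]"] by (intro prod_coprime_left) simp
  moreover have "1 < (2 :: rat) ^ n"
    by (rule one_less_power) (use assms(1) in auto)
  then have "poly ([:0, 1:] ^ n) 2 \<noteq> (poly 1 2 :: rat)"
    by (simp add: poly_power)
  then have "1 - [:0, 1:] ^ n \<noteq> (0 :: rat poly)"
    by (metis eq_iff_diff_eq_0)
  ultimately have "coprime ((\<Prod>i<n. (1 - a_pol * c i * q_pol ^ 3) * (a_pol - c i * q_pol ^ 3))
    - (\<Prod>i<n. a_pol * (1 - c i * q_pol ^ 2) * (1 - c i * q_pol ^ 4))) [:[:1 - [:0, 1:] ^ n:]:]"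
    using assms(1) by (intro coprime_const_poly[of _ 1 0]) (simp_all add: c_def poly_prod poly_power zero_power)
  then show ?thesis
    by (simp add: q_pol_power one_pCons)
qed

lemma quad_sum_cong_0:
  assumes "odd n" and M: "M = (n - 1) div 2 \<or> M = n - 1"
  shows "fract_cong (quad_sum q a b M) 0 (q_int q_pol n)"
proof -
  let ?m = "q_int q_pol n"
  have n: "n > 0" using assms(1) by (rule odd_pos)
  note m = q_int_dvd_modulus[of n]
  note unit = coprime_fr_gens[OF n m] coprime_fr_b_shift[OF n m]
  have "4 * j + 4 \<noteq> n" for j
    using assms(1) by auto
  then have a_unit: "coprime_fr ?m (1 - a * q ^ (4 * j + 4))" "coprime_fr ?m (a - q ^ (4 * j + 4))" for j
    by (intro unit; blast)+
  then have a_nz: "a * q ^ (4 * j + 4) \<noteq> 1" "a \<noteq> q ^ (4 * j + 4)" for j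
    using a_unit[of j, THEN coprime_fr_imp_nonzero] by auto
  have b_nz: "b * q ^ i * q ^ j \<noteq> 1" for i j
    using unit(8)[of i j, THEN coprime_fr_imp_nonzero] by auto
  have weight: "denom_coprime ?m (weight q k)" for k
    unfolding q_def using denom_coprime_weight[OF assms(1)] m by (rule denom_coprime_dvd)
  define S U V where "S = (\<lambda>i. quad_sum q a (b * q ^ (4 * i)) M)"
    and "U = (\<lambda>i. (1 - a * (b * q ^ (4 * i)) * q ^ 3) * (a - b * q ^ (4 * i) * q ^ 3))"
    and "V = (\<lambda>i. a * (1 - b * q ^ (4 * i) * q ^ 2) * (1 - b * q ^ (4 * i) * q ^ 4))"
  have q_n: "fract_cong (q ^ n) 1 ?m"
  proof (rule fract_congI)
    have "to_fr (1 - q_pol ^ n) = to_fr ((1 - q_pol) * ?m)"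
      by (simp only: q_int_mult[OF q_pol_neq_1])
    then show "q ^ n - 1 = to_fr ?m * (- (1 - q))"
      by (simp add: to_fr_simps q_def algebra_simps)
  qed (auto intro: denom_coprime_gens)
  have "fract_cong (b * (q ^ n) ^ 4) (b * 1 ^ 4) ?m"
    by (intro fract_cong_mult fract_cong_power q_n fract_cong_refl denom_coprime_gens)
  then have b_n: "fract_cong (b * q ^ (4 * n)) (b * q ^ (4 * 0)) ?m"
    by (simp add: mult.commute flip: power_mult)
  have S_cong: "fract_cong (S i) (S j) ?m"
    if "fract_cong (b * q ^ (4 * i)) (b * q ^ (4 * j)) ?m" for i j
    unfolding S_def by (intro quad_sum_cong weight denom_coprime_gens fract_cong_refl that a_unit a_nz unit b_nz)
  have S_dc: "denom_coprime ?m (S i)" for i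
    using S_cong[of i i] denom_coprime_gens by (blast dest: fract_cong_imp_denom_coprime)
  have UV_dc: "denom_coprime ?m (U i)" "denom_coprime ?m (V i)" for i
    unfolding U_def V_def
    by (intro denom_coprime_mult denom_coprime_diff denom_coprime_1 denom_coprime_power denom_coprime_gens)+
  have step: "fract_cong (U i * S (Suc i)) (V i * S i) ?m" for i
  proof -
    define c where "c = b * q ^ (4 * i)"
    have c: "c * q ^ (2 * j + 2) \<noteq> 1" "coprime_fr ?m (1 - c * q ^ j)" for j
      unfolding c_def by (rule b_nz unit)+
    have "q \<noteq> 1" "q ^ (4 * j + 4) \<noteq> 1" for j
      using q_power_neq_1[of 1] q_power_neq_1[of "4 * j + 4"] by (auto simp del: power_Suc)
    note rec = quad_sum_recurrence[OF q_neq_0 this a_nz c(1), of M]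
    have "fract_cong (a_factor q a M) (a_factor q a M) ?m"
      "fract_cong (b_factor q c M) (b_factor q c M) ?m"
      by (intro a_factor_cong b_factor_cong denom_coprime_gens fract_cong_refl a_unit a_nz c
        denom_coprime_mult denom_coprime_power | simp only: c_def)+
    then have AB: "denom_coprime ?m (a_factor q a M)" "denom_coprime ?m (b_factor q c M)"
      by (auto dest: fract_cong_imp_denom_coprime)
    have c_dc: "denom_coprime ?m c"
      unfolding c_def by (intro denom_coprime_gens denom_coprime_mult denom_coprime_power)
    have "fract_cong ((1 - q ^ (2 * M + 1)) / (1 - q) * weight q M
       * (a_factor q a M * (1 - a * q ^ (2 * M + 1)) * (a - q ^ (2 * M + 1)))
       * (b_factor q c M * c * q ^ (2 * M + 2) * (1 - c * q ^ 2) * (1 - c * q ^ 4)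
           / ((1 - c * q ^ (2 * M + 2)) * (1 - c * q ^ (2 * M + 4)))))
      (0 * (a_factor q a M * (1 - a * q ^ (2 * M + 1)) * (a - q ^ (2 * M + 1)))
       * (b_factor q c M * c * q ^ (2 * M + 2) * (1 - c * q ^ 2) * (1 - c * q ^ 4)
           / ((1 - c * q ^ (2 * M + 2)) * (1 - c * q ^ (2 * M + 4))))) ?m"
      by (rule fract_cong_mult fract_cong_refl last_weight_cong_0[OF assms, folded q_def]
        denom_coprime_divide denom_coprime_mult denom_coprime_diff denom_coprime_power denom_coprime_1
        coprime_fr_mult AB c c_dc denom_coprime_gens)+
    then have "fract_cong (U i * S (Suc i) - V i * S i) 0 ?m"
      unfolding rec[symmetric] by (simp add: U_def V_def S_def c_def power_add mult_ac)
    then have "fract_cong (U i * S (Suc i) - V i * S i + V i * S i) (0 + V i * S i) ?m"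
      by (intro fract_cong_add fract_cong_refl denom_coprime_mult UV_dc S_dc)
    then show ?thesis by simp
  qed
  have "fract_cong ((\<Prod>i<k. U i) * S k) ((\<Prod>i<k. V i) * S 0) ?m" for k
  proof (induction k)
    case 0
    show ?case by (simp add: S_dc fract_cong_refl)
  next
    case (Suc k)
    have "fract_cong ((\<Prod>i<k. U i) * (U k * S (Suc k))) ((\<Prod>i<k. U i) * (V k * S k)) ?m"
      by (intro fract_cong_mult fract_cong_refl step denom_coprime_prod UV_dc)
    moreover have "fract_cong (V k * ((\<Prod>i<k. U i) * S k)) (V k * ((\<Prod>i<k. V i) * S 0)) ?m"
      by (intro fract_cong_mult fract_cong_refl Suc.IH UV_dc)
    then have "fract_cong ((\<Prod>i<k. U i) * (V k * S k)) (V k * ((\<Prod>i<k. V i) * S 0)) ?m"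
      by (simp only: mult.left_commute)
    ultimately have "fract_cong ((\<Prod>i<k. U i) * (U k * S (Suc k))) (V k * ((\<Prod>i<k. V i) * S 0)) ?m"
      by (rule fract_cong_trans)
    then show ?case
      by (simp add: mult_ac)
  qed
  \<comment> \<open>The subtracted terms contain \<open>S n\<close> on the left and
    \<open>S 0\<close> on the right, which are congruent; subtraction leaves the bracket times
    \<open>S n\<close> on the left and 0 on the right.\<close>
  from this[of n] have "fract_cong ((\<Prod>i<n. U i) * S n - (\<Prod>i<n. V i) * S n)
      ((\<Prod>i<n. V i) * S 0 - (\<Prod>i<n. V i) * S 0) ?m"
    by (rule fract_cong_diff) (intro fract_cong_mult fract_cong_refl denom_coprime_prod UV_dc S_cong b_n)
  then have "fract_cong (((\<Prod>i<n. U i) - (\<Prod>i<n. V i)) * S n) 0 ?m"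
    by (simp add: algebra_simps)
  moreover have bracket: "coprime_fr ?m ((\<Prod>i<n. U i) - (\<Prod>i<n. V i))"
  proof -
    have "coprime_fr (1 - q_pol ^ n) ((\<Prod>i<n. U i) - (\<Prod>i<n. V i))"
      unfolding coprime_fr_def
    proof (intro exI conjI)
      show cop: "coprime ((\<Prod>i<n. (1 - a_pol * (b_pol * q_pol ^ (4 * i)) * q_pol ^ 3)
            * (a_pol - b_pol * q_pol ^ (4 * i) * q_pol ^ 3))
          - (\<Prod>i<n. a_pol * (1 - b_pol * q_pol ^ (4 * i) * q_pol ^ 2) * (1 - b_pol * q_pol ^ (4 * i) * q_pol ^ 4)))
          (1 - q_pol ^ n)" (is "coprime ?d _")
        by (rule coprime_bracket[OF n])
      show "(\<Prod>i<n. U i) - (\<Prod>i<n. V i) = to_fr ?d"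
        unfolding U_def V_def q_def a_def b_def by (simp only: to_fr_simps to_fr_prod)
      \<comment> \<open>If \<open>?d\<close> were 0, coprimality would make
        \<open>1 - q_pol ^ n\<close> a unit, but it vanishes at \<open>q = 1\<close>. With
        \<open>[n]\<close> in its place this would fail for \<open>n = 1\<close>.\<close>
      show "?d \<noteq> 0"
      proof
        assume "?d = 0"
        with cop have "1 - q_pol ^ n dvd 1"
          by (simp only: coprime_0_left_iff)
        then obtain e where "1 = (1 - q_pol ^ n) * e" ..
        then have "eval_pol 1 0 0 1 = eval_pol 1 0 0 (1 - q_pol ^ n) * eval_pol 1 0 0 e"
          by (metis eval_pol_simps(3))
        then show False by simp
      qed
    qed
    then show ?thesis
      using q_int_dvd by (rule coprime_fr_dvd)
  qed
  ultimately have "fract_cong (((\<Prod>i<n. U i) - (\<Prod>i<n. V i)) * S n / ((\<Prod>i<n. U i) - (\<Prod>i<n. V i)))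
     (0 / ((\<Prod>i<n. U i) - (\<Prod>i<n. V i))) ?m"
    using UV_dc by (intro fract_cong_divide fract_cong_refl denom_coprime_diff denom_coprime_prod)
      (auto dest: coprime_fr_imp_nonzero)
  then have "fract_cong (S n) 0 ?m"
    using coprime_fr_imp_nonzero[OF bracket] by simp
  moreover have "fract_cong (S 0) (S n) ?m"
    by (rule fract_cong_sym[OF S_cong[OF b_n]])
  ultimately have "fract_cong (S 0) 0 ?m"
    by (rule fract_cong_trans[rotated])
  then show ?thesis by (simp add: S_def)
qed

definition rhs :: "nat \<Rightarrow> pol fract \<Rightarrow> pol fract \<Rightarrow> pol fract" where
  "rhs N x y =
     ((y - q ^ n) * (x * y - 1 - x ^ 2 + x * q ^ n)) / ((x - y) * (1 - x * y)) * a_value q y N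
     + ((1 - x * q ^ n) * (x - q ^ n)) / ((x - y) * (1 - x * y)) * b_value q x N"

text \<open>Both sides change only by multiples of \<open>p\<close> when \<open>a\<close>,
  \<open>b\<close> are replaced by \<open>a'\<close>, \<open>b'\<close>, so an exact equality at the
  new values yields the congruence at the indeterminates.\<close>

lemma fract_cong_specialize:
  assumes n: "n = 4 * N + 1" and p: "p dvd modulus n"
    and "fract_cong a a' p" "fract_cong b b' p"
    and a': "\<And>j. a' * q ^ (4 * j + 4) \<noteq> 1" "\<And>j. a' \<noteq> q ^ (4 * j + 4)"
    and b': "\<And>j. b' * q ^ (2 * j + 2) \<noteq> 1" and ab': "a' \<noteq> b'" "a' * b' \<noteq> 1"
    and eq: "quad_sum q a' b' M = rhs N a' b'"
  shows "fract_cong (quad_sum q a b M) (rhs N a b) p"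
proof -
  have "n > 0" "odd n" "4 * j + 4 \<noteq> n" for j
    using n by (auto, presburger)
  note unit = coprime_fr_gens[OF \<open>n > 0\<close> p]
  have a_unit: "coprime_fr p (1 - a * q ^ (4 * j + 4))" "coprime_fr p (a - q ^ (4 * j + 4))" for j
    by (rule unit \<open>4 * j + 4 \<noteq> n\<close>)+
  have weight: "denom_coprime p (weight q k)" for k
    unfolding q_def using denom_coprime_weight[OF \<open>odd n\<close>] p by (rule denom_coprime_dvd)
  have b'2: "b' * q ^ (4 * j + 4) \<noteq> 1" for j
  proof -
    have "2 * (2 * j + 1) + 2 = 4 * j + (4::nat)" by simp
    then show ?thesis using b' by metis
  qed
  have nz: "(a' - b') * (1 - a' * b') \<noteq> 0"
    using ab' by simp
  have "fract_cong (quad_sum q a b M) (quad_sum q a' b' M) p"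
    by (intro quad_sum_cong denom_coprime_gens weight assms a_unit unit)
  moreover have "fract_cong (rhs N a b) (rhs N a' b') p"
    unfolding rhs_def
    by (intro fract_cong_add fract_cong_mult fract_cong_divide fract_cong_diff fract_cong_refl fract_cong_power
      a_value_cong b_value_cong denom_coprime_gens denom_coprime_power denom_coprime_1
      coprime_fr_mult assms a_unit unit nz b'2)
  ultimately show ?thesis
    unfolding eq by (blast intro: fract_cong_trans fract_cong_sym)
qed

lemma rhs_cong_0:
  assumes n: "n = 4 * N + 1"
  shows "fract_cong (rhs N a b) 0 (q_int q_pol n)"
proof -
  let ?m = "q_int q_pol n"
  have "n > 0" "odd n" "4 * j + 4 \<noteq> n" for j
    using n by (auto, presburger)
  note unit = coprime_fr_gens[OF \<open>n > 0\<close> q_int_dvd_modulus]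
  note dc = denom_coprime_divide denom_coprime_mult denom_coprime_diff denom_coprime_add denom_coprime_power
    denom_coprime_1 denom_coprime_prod denom_coprime_gens
  have a_unit: "coprime_fr ?m (1 - a * q ^ (4 * j + 4))" "coprime_fr ?m (a - q ^ (4 * j + 4))" for j
    by (rule unit \<open>4 * j + 4 \<noteq> n\<close>)+
  have "fract_cong (a_value q b N) 0 ?m"
    unfolding a_value_def n[symmetric] q_def to_fr_q_int
    by (rule fract_cong_0I[OF dvd_refl], fold q_def) (intro dc coprime_fr_mult unit)
  moreover have "fract_cong (b_value q a N) 0 ?m"
  proof -
    \<comment> \<open>The factor with \<open>i = N - 1\<close> is \<open>1 - q ^ n\<close>. For
      \<open>N = 0\<close> the product is empty, but then \<open>[n] = [1] = 1\<close>.\<close>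
    have "?m dvd (\<Prod>i<N. 1 - q_pol ^ (4 * i + 5))"
    proof (cases N)
      case 0
      then show ?thesis using q_pol_neq_1 by (simp add: n q_int_eq_sum)
    next
      case (Suc N')
      then have "n = 4 * N' + 5" by (simp add: n)
      then have "?m dvd 1 - q_pol ^ (4 * N' + 5)"
        using q_int_dvd[of n] by metis
      then show ?thesis
        unfolding Suc prod.lessThan_Suc by (rule dvd_mult)
    qed
    then have "fract_cong (to_fr (\<Prod>i<N. 1 - q_pol ^ (4 * i + 5))
      * (\<Prod>i<N. a * (1 - q ^ (4 * i + 3)) / ((1 - a * q ^ (4 * i + 4)) * (a - q ^ (4 * i + 4))))) 0 ?m"
      by (rule fract_cong_0I) (intro dc coprime_fr_mult a_unit)
    also have "to_fr (\<Prod>i<N. 1 - q_pol ^ (4 * i + 5))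
      * (\<Prod>i<N. a * (1 - q ^ (4 * i + 3)) / ((1 - a * q ^ (4 * i + 4)) * (a - q ^ (4 * i + 4)))) = b_value q a N"
      unfolding to_fr_prod to_fr_simps prod.distrib[symmetric] b_value_def q_def
      by (simp add: mult_ac)
    finally show ?thesis .
  qed
  ultimately have "fract_cong (rhs N a b)
      (((b - q ^ n) * (a * b - 1 - a ^ 2 + a * q ^ n)) / ((a - b) * (1 - a * b)) * 0
       + ((1 - a * q ^ n) * (a - q ^ n)) / ((a - b) * (1 - a * b)) * 0) ?m"
    unfolding rhs_def
    by (intro fract_cong_add fract_cong_mult fract_cong_refl dc coprime_fr_mult unit)
  then show ?thesis by simp
qed

lemma denom_coprime_quad_sum_rhs:
  assumes n: "n = 4 * N + 1"
  shows "denom_coprime (modulus n) (quad_sum q a b M)" "denom_coprime (modulus n) (rhs N a b)"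
proof -
  have "n > 0" "odd n" "4 * j + 4 \<noteq> n" for j
    using n by (auto, presburger)
  note unit = coprime_fr_gens[OF \<open>n > 0\<close> dvd_refl]
  have a_unit: "coprime_fr (modulus n) (1 - a * q ^ (4 * j + 4))" "coprime_fr (modulus n) (a - q ^ (4 * j + 4))" for j
    by (rule unit \<open>4 * j + 4 \<noteq> n\<close>)+
  note dc = denom_coprime_divide denom_coprime_mult denom_coprime_diff denom_coprime_add denom_coprime_power
    denom_coprime_1 denom_coprime_prod denom_coprime_sum denom_coprime_gens
    denom_coprime_weight[OF \<open>odd n\<close>, folded q_def] coprime_fr_mult
  show "denom_coprime (modulus n) (quad_sum q a b M)"
    unfolding quad_sum_def a_factor_def b_factor_def by (intro dc a_unit unit)
  show "denom_coprime (modulus n) (rhs N a b)"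
    unfolding rhs_def a_value_def b_value_def by (intro dc a_unit unit)
qed

section \<open>Gluing the four congruences\<close>

lemma coprime_factors:
  assumes "n > 0"
  shows "coprime (q_int q_pol n) (1 - a_pol * q_pol ^ n)"
    "coprime (q_int q_pol n) (a_pol - q_pol ^ n)" "coprime (q_int q_pol n) (b_pol - q_pol ^ n)"
    "coprime (1 - a_pol * q_pol ^ n) (a_pol - q_pol ^ n)"
    "coprime (1 - a_pol * q_pol ^ n) (b_pol - q_pol ^ n)"
    "coprime (a_pol - q_pol ^ n) (b_pol - q_pol ^ n)"
proof -
  define v where "v = (2 :: rat) ^ n"
  have v: "1 < v"
    unfolding v_def by (rule one_less_power) (use assms in auto)
  then have "1 < v * v"
    by (metis less_1_mult)
  have "coprime (1 - q_pol ^ n) (1 - a_pol * q_pol ^ n)"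
    by (rule coprime_irreducibleI[where x = 2 and y = "1 / 2 ^ n"], rule irreducible_factors)
      (use v in \<open>auto simp: v_def\<close>)
  moreover have "coprime (1 - q_pol ^ n) (a_pol - q_pol ^ n)"
    by (rule coprime_irreducibleI[where x = 2 and y = "2 ^ n"], rule irreducible_factors)
      (use v in \<open>auto simp: v_def\<close>)
  moreover have "coprime (1 - q_pol ^ n) (b_pol - q_pol ^ n)"
    by (rule coprime_irreducibleI[where x = 2 and z = "2 ^ n"], rule irreducible_factors)
      (use v in \<open>auto simp: v_def\<close>)
  ultimately show "coprime (q_int q_pol n) (1 - a_pol * q_pol ^ n)"
    "coprime (q_int q_pol n) (a_pol - q_pol ^ n)" "coprime (q_int q_pol n) (b_pol - q_pol ^ n)"
    using coprime_divisors[OF q_int_dvd dvd_refl] by blast+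
  show "coprime (1 - a_pol * q_pol ^ n) (a_pol - q_pol ^ n)"
    by (rule coprime_irreducibleI[where x = 2 and y = "2 ^ n"], rule irreducible_factors)
      (use \<open>1 < v * v\<close> in \<open>auto simp: v_def\<close>)
  show "coprime (1 - a_pol * q_pol ^ n) (b_pol - q_pol ^ n)"
    by (rule coprime_irreducibleI[where x = 2 and y = 0 and z = "2 ^ n"], rule irreducible_factors) auto
  show "coprime (a_pol - q_pol ^ n) (b_pol - q_pol ^ n)"
    by (rule coprime_irreducibleI[where x = 2 and y = 0 and z = "2 ^ n"], rule irreducible_factors) auto
qed

lemma fract_cong_rhs:
  assumes n: "n = 4 * N + 1" and M: "M = (n - 1) div 2 \<or> M = n - 1"
  shows "fract_cong (quad_sum q a b M) (rhs N a b)
    (q_int q_pol n * (1 - a_pol * q_pol ^ n) * (a_pol - q_pol ^ n) * (b_pol - q_pol ^ n))"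
proof -
  have "n > 0" "odd n" and n_ne: "n \<noteq> 4 * j + 4" for j
    using n by (auto, presburger)
  \<comment> \<open>\<open>2 * N\<close> is \<open>(n - 1) / 2\<close>, the smaller of the two upper
    limits, so both closed forms apply to either choice of \<open>M\<close>.\<close>
  have MN: "2 * N \<le> M" "N \<le> M"
    using M n by auto
  define Q where "Q = q ^ n"
  have dvds: "1 - a_pol * q_pol ^ n dvd modulus n" "a_pol - q_pol ^ n dvd modulus n"
    "b_pol - q_pol ^ n dvd modulus n"
    unfolding modulus_def by (metis dvd_triv_left dvd_triv_right dvd_mult2)+
  note unit = coprime_fr_gens[OF \<open>n > 0\<close> dvd_refl, THEN coprime_fr_imp_nonzero]
  have "Q \<noteq> 0"
    using q_neq_0 by (simp add: Q_def)
  have Q_q: "Q * q ^ k \<noteq> 1" for k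
    unfolding Q_def power_add[symmetric] using \<open>n > 0\<close> by (intro q_power_neq_1) simp
  have Q_q': "Q \<noteq> q ^ (4 * j + 4)" for j
    unfolding Q_def using q_power_eq_iff[OF q_neq_0 q_power_neq_1] n_ne by blast
  have bQ: "b * q ^ k \<noteq> 1" "b * Q \<noteq> 1" for k
    using unit(5) by (auto simp: Q_def)
  have aQ: "a * q ^ (4 * j + 4) \<noteq> 1" "a \<noteq> q ^ (4 * j + 4)" for j
    using unit(3,4)[OF n_ne[THEN not_sym]] by auto
  have irr: "x \<noteq> 0" if "irreducible x" for x :: pol
    using that by auto
  have "to_fr (1 - a_pol * q_pol ^ n) \<noteq> 0" "to_fr (a_pol - q_pol ^ n) \<noteq> 0" "to_fr (b_pol - q_pol ^ n) \<noteq> 0"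
    using irreducible_factors[of n, THEN irr] by simp_all
  then have ne: "1 - a * Q \<noteq> 0" "a - Q \<noteq> 0" "b - Q \<noteq> 0"
    by (simp_all add: to_fr_simps Q_def q_def a_def b_def)
  note assoc = a_def b_def q_def Q_def to_fr_simps
  have c1: "fract_cong (quad_sum q a b M) (rhs N a b) (1 - a_pol * q_pol ^ n)" (is "fract_cong _ _ ?p")
  proof (rule fract_cong_specialize[OF n dvds(1)])
    have "coprime_fr ?p Q"
      unfolding Q_def by (intro coprime_fr_power coprime_fr_gens[OF \<open>n > 0\<close> dvds(1)])
    show "fract_cong a (1 / Q) ?p"
    proof (rule fract_congI)
      have "to_fr ?p = 1 - a * Q" "to_fr (- 1) = (- 1 :: pol fract)"
        by (simp_all only: assoc)
      then show "a - 1 / Q = to_fr ?p * (to_fr (- 1) / Q)"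
        using \<open>Q \<noteq> 0\<close> by (simp only:) (simp add: field_simps)
    qed (use \<open>coprime_fr ?p Q\<close> denom_coprime_gens in auto)
    show "fract_cong b b ?p"
      by (rule fract_cong_refl[OF denom_coprime_gens(3)])
    show "1 / Q * q ^ (4 * j + 4) \<noteq> 1" "1 / Q \<noteq> q ^ (4 * j + 4)" for j
      using Q_q[of "4 * j + 4"] Q_q'[of j] \<open>Q \<noteq> 0\<close> by (auto simp: divide_eq_eq mult.commute)
    show "b * q ^ (2 * j + 2) \<noteq> 1" for j
      by (rule bQ)
    show 1: "1 / Q \<noteq> b" "1 / Q * b \<noteq> 1"
      using bQ(2) ne(3) \<open>Q \<noteq> 0\<close> by (auto simp: divide_eq_eq)
    have "quad_sum q (1 / Q) b M = a_value q b N"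
    proof (rule quad_sum_eq_a_value[OF q_neq_0 q_power_neq_1])
      show "b * q ^ (2 * j + 2) \<noteq> 1" for j
        by (rule bQ)
    qed (use n Q_def MN in simp_all)
    \<comment> \<open>This makes the coefficient of \<open>a_value\<close> in \<open>rhs\<close>
      equal to 1; that of \<open>b_value\<close> contains the factor
      \<open>1 - 1 / Q * Q = 0\<close>.\<close>
    moreover have "(b - Q) * (1 / Q * b - 1 - (1 / Q)\<^sup>2 + 1 / Q * Q) = (1 / Q - b) * (1 - 1 / Q * b)"
      using \<open>Q \<noteq> 0\<close> by (simp add: field_simps power2_eq_square)
    ultimately show "quad_sum q (1 / Q) b M = rhs N (1 / Q) b"
      using 1 \<open>Q \<noteq> 0\<close> unfolding rhs_def Q_def[symmetric] by simp
  qed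
  have c2: "fract_cong (quad_sum q a b M) (rhs N a b) (a_pol - q_pol ^ n)" (is "fract_cong _ _ ?p")
  proof (rule fract_cong_specialize[OF n dvds(2)])
    show "fract_cong a Q ?p"
    proof (rule fract_congI)
      show "a - Q = to_fr ?p * 1"
        by (simp only: assoc mult_1_right)
    qed (use denom_coprime_gens Q_def in auto)
    show "fract_cong b b ?p"
      by (rule fract_cong_refl[OF denom_coprime_gens(3)])
    show "Q * q ^ (4 * j + 4) \<noteq> 1" "Q \<noteq> q ^ (4 * j + 4)" for j
      by (rule Q_q Q_q')+
    show "b * q ^ (2 * j + 2) \<noteq> 1" for j
      by (rule bQ)
    show 1: "Q \<noteq> b" "Q * b \<noteq> 1"
      using bQ(2) ne(3) by (auto simp: mult.commute)
    have "quad_sum q Q b M = a_value q b N"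
    proof (rule quad_sum_eq_a_value[OF q_neq_0 q_power_neq_1])
      show "b * q ^ (2 * j + 2) \<noteq> 1" for j
        by (rule bQ)
    qed (use n Q_def MN in simp_all)
    moreover have "(b - Q) * (Q * b - 1 - Q\<^sup>2 + Q * Q) = (Q - b) * (1 - Q * b)"
      by algebra
    ultimately show "quad_sum q Q b M = rhs N Q b"
      using 1 unfolding rhs_def Q_def[symmetric] by simp
  qed
  have c3: "fract_cong (quad_sum q a b M) (rhs N a b) (b_pol - q_pol ^ n)" (is "fract_cong _ _ ?p")
  proof (rule fract_cong_specialize[OF n dvds(3)])
    show "fract_cong b Q ?p"
    proof (rule fract_congI)
      show "b - Q = to_fr ?p * 1"
        by (simp only: assoc mult_1_right)
    qed (use denom_coprime_gens Q_def in auto)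
    show "fract_cong a a ?p"
      by (rule fract_cong_refl[OF denom_coprime_gens(2)])
    show "Q * q ^ (2 * j + 2) \<noteq> 1" for j
      by (rule Q_q)
    show "a * q ^ (4 * j + 4) \<noteq> 1" "a \<noteq> q ^ (4 * j + 4)" for j
      by (rule aQ)+
    show "a \<noteq> Q" "a * Q \<noteq> 1"
      using ne by auto
    have "quad_sum q a Q M = b_value q a N"
      unfolding Q_def n by (rule quad_sum_eq_b_value[OF q_neq_0 q_power_neq_1 aQ MN(2)])
    then show "quad_sum q a Q M = rhs N a Q"
      using ne unfolding rhs_def Q_def[symmetric] by simp
  qed
  have c0: "fract_cong (quad_sum q a b M) (rhs N a b) (q_int q_pol n)"
    using quad_sum_cong_0[OF \<open>odd n\<close> M] rhs_cong_0[OF n] by (blast intro: fract_cong_trans fract_cong_sym)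
  have P: "q_int q_pol n * (1 - a_pol * q_pol ^ n) * (a_pol - q_pol ^ n) * (b_pol - q_pol ^ n) dvd modulus n"
    unfolding modulus_def by (intro mult_dvd_mono dvd_refl q_int_dvd)
  have dc: "denom_coprime p (quad_sum q a b M)" "denom_coprime p (rhs N a b)" if "p dvd modulus n" for p
    using denom_coprime_quad_sum_rhs[OF n] that by (blast intro: denom_coprime_dvd)+
  note cop = coprime_factors[OF \<open>n > 0\<close>]
  from P have "q_int q_pol n * (1 - a_pol * q_pol ^ n) dvd modulus n"
    "q_int q_pol n * (1 - a_pol * q_pol ^ n) * (a_pol - q_pol ^ n) dvd modulus n"
    by (blast intro: dvd_mult_left)+
  with cop P show ?thesis
    by (intro fract_cong_mult_modulus c0 c1 c2 c3 dc) simp_all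
qed

end

theorem theorem2p2:
  fixes n M :: nat and q a b :: "pol fract"
  defines "q \<equiv> to_fr q_pol" and "a \<equiv> to_fr a_pol" and "b \<equiv> to_fr b_pol"
  assumes "n > 0" and "n mod 4 = 1"
    and "M = (n - 1) div 2 \<or> M = n - 1"
  shows "fract_cong
    (\<Sum>k=0..M. q_int q (6 * k + 1)
        * ((q_pochs [q, a * q, q / a] (q ^ 2) k * q_poch (q / b) (q ^ 4) k)
           / (q_pochs [q ^ 4, q ^ 4 / a, a * q ^ 4] (q ^ 4) k * q_poch (b * q ^ 2) (q ^ 2) k))
        * q ^ (k ^ 2 + k) * b ^ k)
    (((b - q ^ n) * (a * b - 1 - a ^ 2 + a * q ^ n)) / ((a - b) * (1 - a * b))
        * (q_pochs [q ^ 5, q ^ 2 / b] (q ^ 4) ((n - 1) div 4)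
           / q_pochs [q, b * q ^ 4] (q ^ 4) ((n - 1) div 4))
        * (b / q) ^ ((n - 1) div 4)
     + ((1 - a * q ^ n) * (a - q ^ n)) / ((a - b) * (1 - a * b))
        * (q_pochs [q ^ 3, q ^ 5] (q ^ 4) ((n - 1) div 4)
           / q_pochs [a * q ^ 4, q ^ 4 / a] (q ^ 4) ((n - 1) div 4)))
    (q_int q_pol n * (1 - a_pol * q_pol ^ n) * (a_pol - q_pol ^ n) * (b_pol - q_pol ^ n))"
proof -
  obtain N where N: "n = 4 * N + 1"
    using assms(5) by (metis mult.commute div_mult_mod_eq)
  then have Nd: "(n - 1) div 4 = N"
    by simp
  have nz: "a \<noteq> 0" "b \<noteq> 0"
    using coprime_fr_modulus(2)[of 1, THEN coprime_fr_imp_nonzero]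
    by (simp_all add: a_def b_def b_pol_def)
  have q: "q ^ i \<noteq> 1" if "i > 0" for i
    unfolding q_def using that by (rule to_fr_q_power_neq_1)
  have "(\<Sum>k=0..M. q_int q (6 * k + 1)
        * ((q_pochs [q, a * q, q / a] (q ^ 2) k * q_poch (q / b) (q ^ 4) k)
           / (q_pochs [q ^ 4, q ^ 4 / a, a * q ^ 4] (q ^ 4) k * q_poch (b * q ^ 2) (q ^ 2) k))
        * q ^ (k ^ 2 + k) * b ^ k) = quad_sum q a b M"
    unfolding quad_sum_def atMost_atLeast0
    by (rule sum.cong[OF refl]) (simp only: mult.assoc summand_eq[OF nz, unfolded mult.assoc])
  moreover have "((b - q ^ n) * (a * b - 1 - a ^ 2 + a * q ^ n)) / ((a - b) * (1 - a * b))
        * (q_pochs [q ^ 5, q ^ 2 / b] (q ^ 4) ((n - 1) div 4)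
           / q_pochs [q, b * q ^ 4] (q ^ 4) ((n - 1) div 4))
        * (b / q) ^ ((n - 1) div 4)
     + ((1 - a * q ^ n) * (a - q ^ n)) / ((a - b) * (1 - a * b))
        * (q_pochs [q ^ 3, q ^ 5] (q ^ 4) ((n - 1) div 4)
           / q_pochs [a * q ^ 4, q ^ 4 / a] (q ^ 4) ((n - 1) div 4)) = rhs n N a b"
    unfolding Nd b_value_eq[OF nz(1)] rhs_def q_def[symmetric]
    using a_value_eq[of b q N] nz(2) q by (simp only: mult.assoc) simp
  ultimately show ?thesis
    using fract_cong_rhs[OF N assms(6)] unfolding q_def[symmetric] a_def[symmetric] b_def[symmetric] by simp
qed

end
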